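(* Let $X=(\coprod\sigma_i)/\!\sim$ be an ideal stacky fan with cells $\{\sigma_i^0/\!\sim\}$ and inclusions of faces $\{L_\alpha\}$, and suppose we have an admissible action of a group $G$ on $X$. Let $\{\sigma_j\}_{j\in\mathcal J}$ be a set of $G$-orbit representatives of the cones. Then the stratified quotient $X/\!/G=(\coprod_{j\in\mathcal J}\sigma_j)/\!\sim'$ is an ideal stacky fan with cells $\{\sigma_j^0/\!\sim'\}_{j\in\mathcal J}$, and the map $X\to X/\!/G$ is a morphism of ideal stacky fans.
   Context: A rational polyhedral cone in a finite-dimensional real vector space $V$ with a fixed lattice $N$ is a closed convex set $\bar\sigma=\{\sum_k\lambda_kx_k:\lambda_k\ge0\}$ for finitely many $x_k\in N$. An ideal cone $\sigma$ is a convex subset of $V$ obtained from such a $\bar\sigma$ by removing some (possibly none) of its faces; $\sigma^0$ is its relative interior; a face of $\sigma$ is the intersection of $\sigma$ with a face of $\bar\sigma$. A linear map $L:V\to V'$ (lattices $N,N'$) is integral if $L(N)\subseteq N'$; for ideal cones $\sigma\subseteq V$, $\sigma'\subseteq V'$ it is a lattice-preserving inclusion if it induces an inclusion $\sigma\hookrightarrow\sigma'$ identifying $\sigma$ with a face of $\sigma'$ and $L(N\cap\operatorname{span}\sigma)=N'\cap L(\operatorname{span}\sigma)$. Given a (possibly infinite) collection of ideal cones $\{\sigma_i\subseteq V_i\}$ in finite-dimensional real vector spaces with lattices and a collection of lattice-preserving inclusions $L_\alpha:\sigma_i\hookrightarrow\sigma_j$ ($i=j$ allowed; called inclusions of faces),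 let $X=(\coprod\sigma_i)/\!\sim$ with the quotient topology, $\sim$ generated by $x\sim L_\alpha(x)$. If $X=\coprod(\sigma_i^0/\!\sim)$ as sets (every point is represented by a point of $\sigma_i^0$ for exactly one $i$), $X$ is an ideal stacky fan with cells $\{\sigma_i^0/\!\sim\}$. A morphism of ideal stacky fans $f:X\to Y$ is a continuous map such that for every cone $\sigma_i$ of $X$ there are a cone $\tau_j$ of $Y$ and an integral linear map $L:\sigma_i\to\tau_j$ such that the compositions $\sigma_i\to X\xrightarrow{f}Y$ and $\sigma_i\xrightarrow{L}\tau_j\to Y$ agree. An action of $G$ on $X$ is admissible if for each $\gamma\in G$ and each $\sigma_i$ there are some (necessarily unique) $\sigma_j=:\sigma_i\cdot\gamma$ and a lattice-preserving isomorphism $L_{\gamma,i}:\sigma_i\to\sigma_j$ such that $\sigma_i\to X\xrightarrow{\gamma}X$ equals $\sigma_i\xrightarrow{L_{\gamma,i}}\sigma_j\to X$; then $\sigma_i,\sigma_j$ are said to be in the same $G$-orbit. The stratified quotient is $X/\!/G=(\coprod_{j\in\mathcal J}\sigma_j)/\!\sim'$, where the quotient is over all identifications given by composite maps of the form $\sigma_i\xrightarrow{L_{\gamma,i}}\sigma_i\cdot\gamma\xrightarrow{L_\alpha}\sigma_j$ for all $\gamma\in G$ and all $i,j$ in $\mathcal J$. The map $X\to X/\!/G$ is the one induced by sending each cone $\sigma_i$ to its orbit representative via a map $L_{\gamma,i}$.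
   Formalization: In the identifications defining ∼', L_α ranges over all lattice-preserving inclusions of faces between cones of X compatible with the maps to X, not only the listed ones; with a listed collection not stable under G the quotient can fail to be an ideal stacky fan. *)

theory Defs
  imports "HOL-Analysis.Analysis" "HOL-Algebra.Group"
begin

section \<open>Ideal cones\<close>

text \<open>
  The vector spaces \<open>V\<close> carrying the cones are finite-dimensional subspaces of one normed
  type \<open>'v\<close>. The type \<open>'v\<close> itself may have infinite dimension, so the dimensions occurring in an
  infinite collection of cones need not be bounded, and any collection of finite-dimensional real
  vector spaces embeds in such a type (take the direct sum). The subspace topology on a
  finite-dimensional subspace is its standard topology.
\<close>

definition is_lattice_in :: "'v::real_vector set \<Rightarrow> 'v set \<Rightarrow> bool" where
  "is_lattice_in V N \<longleftrightarrow>
     (\<exists>B. finite B \<and> independent B \<and> V = span B \<and>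
          N = {\<Sum>b\<in>B. of_int (k b) *\<^sub>R b | k :: 'v \<Rightarrow> int. True})"

definition rational_polyhedral_cone :: "'v::real_vector set \<Rightarrow> 'v set \<Rightarrow> bool" where
  "rational_polyhedral_cone N C \<longleftrightarrow>
     (\<exists>S. finite S \<and> S \<subseteq> N \<and> C = {\<Sum>x\<in>S. c x *\<^sub>R x | c :: 'v \<Rightarrow> real. \<forall>x\<in>S. 0 \<le> c x})"

text \<open>
  \<open>\<sigma>\<close> arises from \<open>C\<close> by removing a collection of faces. The faces removed are meant to be
  proper ones: \<open>\<sigma> \<noteq> {}\<close> says that \<open>C\<close> itself is not among them.
\<close>

definition ideal_cone_from :: "'v::real_vector set \<Rightarrow> 'v set \<Rightarrow> 'v set \<Rightarrow> bool" where
  "ideal_cone_from N C \<sigma> \<longleftrightarrow>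
     rational_polyhedral_cone N C \<and> convex \<sigma> \<and> \<sigma> \<noteq> {} \<and>
     (\<exists>\<F>. (\<forall>F\<in>\<F>. F face_of C) \<and> \<sigma> = C - \<Union>\<F>)"

definition ideal_cone_face :: "'v::real_vector set \<Rightarrow> 'v set \<Rightarrow> 'v set \<Rightarrow> bool" where
  "ideal_cone_face N T \<sigma> \<longleftrightarrow>
     (\<exists>C F. ideal_cone_from N C \<sigma> \<and> F face_of C \<and> T = \<sigma> \<inter> F)"

text \<open>The data of an ideal cone: the ambient space \<open>V\<close>, the lattice \<open>N\<close> and the cone \<open>\<sigma>\<close>.\<close>

record 'v lattice_cone =
  amb :: "'v set"
  lat :: "'v set"
  pts :: "'v set"

definition ideal_cone :: "'v::real_vector lattice_cone \<Rightarrow> bool" where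
  "ideal_cone c \<longleftrightarrow> is_lattice_in (amb c) (lat c) \<and> (\<exists>C. ideal_cone_from (lat c) C (pts c))"

text \<open>
  A linear map between the subspaces \<open>V\<close> and \<open>V'\<close> is given as the restriction of a linear map
  between the surrounding types; every linear map \<open>V \<rightarrow> V'\<close> is of this form.
\<close>

definition integral_linear ::
    "'v::real_vector lattice_cone \<Rightarrow> 'w::real_vector lattice_cone \<Rightarrow> ('v \<Rightarrow> 'w) \<Rightarrow> bool" where
  "integral_linear c d L \<longleftrightarrow> linear L \<and> L ` amb c \<subseteq> amb d \<and> L ` lat c \<subseteq> lat d"

definition lattice_preserving_inclusion ::
    "'v::real_vector lattice_cone \<Rightarrow> 'w::real_vector lattice_cone \<Rightarrow> ('v \<Rightarrow> 'w) \<Rightarrow> bool" where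
  "lattice_preserving_inclusion c d L \<longleftrightarrow>
     integral_linear c d L \<and>
     inj_on L (pts c) \<and>
     ideal_cone_face (lat d) (L ` pts c) (pts d) \<and>
     L ` (lat c \<inter> span (pts c)) = lat d \<inter> L ` span (pts c)"

definition lattice_preserving_isomorphism ::
    "'v::real_vector lattice_cone \<Rightarrow> 'w::real_vector lattice_cone \<Rightarrow> ('v \<Rightarrow> 'w) \<Rightarrow> bool" where
  "lattice_preserving_isomorphism c d L \<longleftrightarrow>
     lattice_preserving_inclusion c d L \<and> L ` pts c = pts d"


section \<open>Gluing cones\<close>

text \<open>
  A collection of cones indexed by \<open>idx\<close>, together with a collection of maps; \<open>(i, j, L) \<in> incls\<close>
  stands for a map \<open>L\<close> from the \<open>i\<close>-th to the \<open>j\<close>-th cone.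
\<close>

record ('i, 'v) cone_diagram =
  idx :: "'i set"
  cones :: "'i \<Rightarrow> 'v lattice_cone"
  incls :: "('i \<times> 'i \<times> ('v \<Rightarrow> 'v)) set"

definition cone_coproduct :: "('i, 'v::real_normed_vector) cone_diagram \<Rightarrow> ('i \<times> 'v) topology" where
  "cone_coproduct X = sum_topology (\<lambda>i. top_of_set (pts (cones X i))) (idx X)"

definition basic_glue :: "('i, 'v::real_normed_vector) cone_diagram \<Rightarrow> 'i \<times> 'v \<Rightarrow> 'i \<times> 'v \<Rightarrow> bool" where
  "basic_glue X p q \<longleftrightarrow> (\<exists>(i, j, L)\<in>incls X. \<exists>x\<in>pts (cones X i). p = (i, x) \<and> q = (j, L x))"

definition glue_rel :: "('i, 'v::real_normed_vector) cone_diagram \<Rightarrow> (('i \<times> 'v) \<times> ('i \<times> 'v)) set" where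
  "glue_rel X = {(p, q). p \<in> topspace (cone_coproduct X) \<and> q \<in> topspace (cone_coproduct X) \<and>
                         equivclp (basic_glue X) p q}"

text \<open>The map from the \<open>i\<close>-th cone to the glued space; points of the latter are equivalence classes.\<close>

definition fan_pt :: "('i, 'v::real_normed_vector) cone_diagram \<Rightarrow> 'i \<Rightarrow> 'v \<Rightarrow> ('i \<times> 'v) set" where
  "fan_pt X i x = glue_rel X `` {(i, x)}"

definition fan_space :: "('i, 'v::real_normed_vector) cone_diagram \<Rightarrow> ('i \<times> 'v) set topology" where
  "fan_space X = topology (\<lambda>U. U \<subseteq> topspace (cone_coproduct X) // glue_rel X \<and>
     openin (cone_coproduct X) {p \<in> topspace (cone_coproduct X). glue_rel X `` {p} \<in> U})"

lemma equiv_glue_rel: "equiv (topspace (cone_coproduct X)) (glue_rel X)"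
proof (rule equivI)
  show "glue_rel X \<subseteq> topspace (cone_coproduct X) \<times> topspace (cone_coproduct X)"
    by (auto simp: glue_rel_def)
  show "refl_on (topspace (cone_coproduct X)) (glue_rel X)"
    by (auto simp: refl_on_def glue_rel_def)
  show "sym (glue_rel X)"
    by (auto simp: sym_def glue_rel_def intro: equivclp_sym)
  show "trans (glue_rel X)"
    by (auto simp: trans_def glue_rel_def intro: equivclp_trans)
qed

lemma openin_fan_space:
  "openin (fan_space X) U \<longleftrightarrow> U \<subseteq> topspace (cone_coproduct X) // glue_rel X \<and>
     openin (cone_coproduct X) {p \<in> topspace (cone_coproduct X). glue_rel X `` {p} \<in> U}"
proof -
  let ?T = "topspace (cone_coproduct X)"
  let ?pre = "\<lambda>U. {p \<in> ?T. glue_rel X `` {p} \<in> U}"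
  have "istopology (\<lambda>U. U \<subseteq> ?T // glue_rel X \<and> openin (cone_coproduct X) (?pre U))"
    unfolding istopology_def
  proof (intro conjI allI impI)
    fix S T
    assume S: "S \<subseteq> ?T // glue_rel X \<and> openin (cone_coproduct X) (?pre S)"
      and T: "T \<subseteq> ?T // glue_rel X \<and> openin (cone_coproduct X) (?pre T)"
    show "S \<inter> T \<subseteq> ?T // glue_rel X" using S by blast
    have "?pre (S \<inter> T) = ?pre S \<inter> ?pre T" by blast
    then show "openin (cone_coproduct X) (?pre (S \<inter> T))" by (simp only: openin_Int S T)
  next
    fix K
    assume K: "\<forall>S\<in>K. S \<subseteq> ?T // glue_rel X \<and> openin (cone_coproduct X) (?pre S)"
    show "\<Union>K \<subseteq> ?T // glue_rel X" using K by blast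
    have "?pre (\<Union>K) = (\<Union>S\<in>K. ?pre S)" by blast
    moreover have "openin (cone_coproduct X) (\<Union>S\<in>K. ?pre S)"
      by (rule openin_Union) (use K in blast)
    ultimately show "openin (cone_coproduct X) (?pre (\<Union>K))" by (simp only:)
  qed
  then show ?thesis by (simp add: fan_space_def)
qed

lemma topspace_fan_space: "topspace (fan_space X) = topspace (cone_coproduct X) // glue_rel X"
proof
  show "topspace (fan_space X) \<subseteq> topspace (cone_coproduct X) // glue_rel X"
    using openin_fan_space[of X "topspace (fan_space X)"] by simp
  have "{p \<in> topspace (cone_coproduct X). glue_rel X `` {p} \<in> topspace (cone_coproduct X) // glue_rel X}
          = topspace (cone_coproduct X)"
    by (auto intro: quotientI)
  then have "openin (fan_space X) (topspace (cone_coproduct X) // glue_rel X)"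
    by (simp add: openin_fan_space)
  then show "topspace (cone_coproduct X) // glue_rel X \<subseteq> topspace (fan_space X)"
    by (rule openin_subset)
qed

lemma quotient_map_fan_space:
  "quotient_map (cone_coproduct X) (fan_space X) (\<lambda>(i, x). fan_pt X i x)"
proof -
  have "(\<lambda>(i, x). fan_pt X i x) = (\<lambda>p. glue_rel X `` {p})"
    by (auto simp: fan_pt_def)
  then show ?thesis
    unfolding quotient_map_def topspace_fan_space openin_fan_space
    by (auto simp: quotient_def)
qed


section \<open>Ideal stacky fans and their morphisms\<close>

definition ideal_stacky_fan :: "('i, 'v::real_normed_vector) cone_diagram \<Rightarrow> bool" where
  "ideal_stacky_fan X \<longleftrightarrow>
     (\<forall>i\<in>idx X. ideal_cone (cones X i)) \<and>
     (\<forall>(i, j, L)\<in>incls X. i \<in> idx X \<and> j \<in> idx X \<and>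
        lattice_preserving_inclusion (cones X i) (cones X j) L) \<and>
     (\<forall>p\<in>topspace (fan_space X).
        \<exists>!i. i \<in> idx X \<and> (\<exists>x\<in>rel_interior (pts (cones X i)). fan_pt X i x = p))"

definition fan_morphism ::
    "('i, 'v::real_normed_vector) cone_diagram \<Rightarrow> ('j, 'w::real_normed_vector) cone_diagram \<Rightarrow>
     (('i \<times> 'v) set \<Rightarrow> ('j \<times> 'w) set) \<Rightarrow> bool" where
  "fan_morphism X Y f \<longleftrightarrow>
     continuous_map (fan_space X) (fan_space Y) f \<and>
     (\<forall>i\<in>idx X. \<exists>j\<in>idx Y. \<exists>L. integral_linear (cones X i) (cones Y j) L \<and>
        L ` pts (cones X i) \<subseteq> pts (cones Y j) \<and>
        (\<forall>x\<in>pts (cones X i). f (fan_pt X i x) = fan_pt Y j (L x)))"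


section \<open>Group actions and the stratified quotient\<close>

text \<open>Right actions by continuous maps: \<open>act \<gamma> p\<close> is \<open>p \<cdot> \<gamma>\<close>.\<close>

definition fan_action ::
    "('g, 'm) monoid_scheme \<Rightarrow> ('i, 'v::real_normed_vector) cone_diagram \<Rightarrow>
     ('g \<Rightarrow> ('i \<times> 'v) set \<Rightarrow> ('i \<times> 'v) set) \<Rightarrow> bool" where
  "fan_action G X act \<longleftrightarrow>
     group G \<and>
     (\<forall>\<gamma>\<in>carrier G. continuous_map (fan_space X) (fan_space X) (act \<gamma>)) \<and>
     (\<forall>p\<in>topspace (fan_space X). act \<one>\<^bsub>G\<^esub> p = p) \<and>
     (\<forall>\<gamma>\<in>carrier G. \<forall>\<delta>\<in>carrier G. \<forall>p\<in>topspace (fan_space X).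
        act (\<gamma> \<otimes>\<^bsub>G\<^esub> \<delta>) p = act \<delta> (act \<gamma> p))"

text \<open>\<open>L\<close> is a lattice-preserving isomorphism from the \<open>i\<close>-th to the \<open>j\<close>-th cone covering \<open>\<gamma>\<close>.\<close>

definition covers ::
    "('i, 'v::real_normed_vector) cone_diagram \<Rightarrow> ('g \<Rightarrow> ('i \<times> 'v) set \<Rightarrow> ('i \<times> 'v) set) \<Rightarrow>
     'g \<Rightarrow> 'i \<Rightarrow> 'i \<Rightarrow> ('v \<Rightarrow> 'v) \<Rightarrow> bool" where
  "covers X act \<gamma> i j L \<longleftrightarrow>
     j \<in> idx X \<and>
     lattice_preserving_isomorphism (cones X i) (cones X j) L \<and>
     (\<forall>x\<in>pts (cones X i). act \<gamma> (fan_pt X i x) = fan_pt X j (L x))"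

definition admissible_action ::
    "('g, 'm) monoid_scheme \<Rightarrow> ('i, 'v::real_normed_vector) cone_diagram \<Rightarrow>
     ('g \<Rightarrow> ('i \<times> 'v) set \<Rightarrow> ('i \<times> 'v) set) \<Rightarrow> bool" where
  "admissible_action G X act \<longleftrightarrow>
     fan_action G X act \<and> (\<forall>\<gamma>\<in>carrier G. \<forall>i\<in>idx X. \<exists>j L. covers X act \<gamma> i j L)"

text \<open>
  A choice of the cones \<open>\<sigma>\<^sub>i \<cdot> \<gamma>\<close> (index \<open>dot i \<gamma>\<close>, forced by the action) and of the maps
  \<open>L\<^sub>\<gamma>\<^sub>,\<^sub>i\<close> (not unique in general).
\<close>

definition covering_choice ::
    "('g, 'm) monoid_scheme \<Rightarrow> ('i, 'v::real_normed_vector) cone_diagram \<Rightarrow>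
     ('g \<Rightarrow> ('i \<times> 'v) set \<Rightarrow> ('i \<times> 'v) set) \<Rightarrow>
     ('i \<Rightarrow> 'g \<Rightarrow> 'i) \<Rightarrow> ('g \<Rightarrow> 'i \<Rightarrow> 'v \<Rightarrow> 'v) \<Rightarrow> bool" where
  "covering_choice G X act dot L \<longleftrightarrow>
     (\<forall>\<gamma>\<in>carrier G. \<forall>i\<in>idx X. covers X act \<gamma> i (dot i \<gamma>) (L \<gamma> i))"

definition orbit_representatives ::
    "('g, 'm) monoid_scheme \<Rightarrow> ('i, 'v) cone_diagram \<Rightarrow> ('i \<Rightarrow> 'g \<Rightarrow> 'i) \<Rightarrow> 'i set \<Rightarrow> bool" where
  "orbit_representatives G X dot J \<longleftrightarrow>
     J \<subseteq> idx X \<and> (\<forall>i\<in>idx X. \<exists>!j. j \<in> J \<and> (\<exists>\<gamma>\<in>carrier G. j = dot i \<gamma>))"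

text \<open>
  All inclusions of faces between the cones of \<open>X\<close>: the lattice-preserving inclusions commuting with
  the maps to the glued space. They contain the gluing maps \<open>incls X\<close> and the identities, and gluing
  along all of them yields the same space as gluing along \<open>incls X\<close>.
\<close>

definition face_incls ::
    "('i, 'v::real_normed_vector) cone_diagram \<Rightarrow> ('i \<times> 'i \<times> ('v \<Rightarrow> 'v)) set" where
  "face_incls X = {(i, j, M). i \<in> idx X \<and> j \<in> idx X \<and>
     lattice_preserving_inclusion (cones X i) (cones X j) M \<and>
     (\<forall>x\<in>pts (cones X i). fan_pt X j (M x) = fan_pt X i x)}"

lemma incls_subset_face_incls:
  assumes "ideal_stacky_fan X"
  shows "incls X \<subseteq> face_incls X"
proof
  fix t assume t: "t \<in> incls X"
  obtain i j M where [simp]: "t = (i, j, M)" by (cases t)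
  have ij: "i \<in> idx X" "j \<in> idx X" and M: "lattice_preserving_inclusion (cones X i) (cones X j) M"
    using assms t by (auto simp: ideal_stacky_fan_def)
  have "fan_pt X j (M x) = fan_pt X i x" if x: "x \<in> pts (cones X i)" for x
  proof -
    have "M x \<in> pts (cones X j)"
      using M x by (auto simp: lattice_preserving_inclusion_def ideal_cone_face_def)
    moreover have "basic_glue X (i, x) (j, M x)"
      using t x by (force simp: basic_glue_def)
    ultimately have "((i, x), (j, M x)) \<in> glue_rel X"
      using ij x by (auto simp: glue_rel_def cone_coproduct_def)
    then show ?thesis
      unfolding fan_pt_def by (metis equiv_class_eq equiv_glue_rel)
  qed
  then show "t \<in> face_incls X" using ij M by (simp add: face_incls_def)
qed

text \<open>
  In the composites \<open>\<sigma>\<^sub>i \<rightarrow> \<sigma>\<^sub>i \<cdot> \<gamma> \<rightarrow> \<sigma>\<^sub>j\<close> the second map ranges over all inclusions of faces, not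
  only over the gluing maps listed in \<open>incls X\<close>. The two agree if \<open>incls X\<close> lists all of them. For a
  list that is not stable under the group, the listed maps do not suffice: the translate by \<open>\<gamma>\<close> of a
  listed map is an inclusion of faces but need not be listed, so that the images in \<open>J\<close> of two glued
  cones may fail to be glued, and the outcome is then not an ideal stacky fan with one cell for each
  element of \<open>J\<close>.
\<close>

definition stratified_quotient ::
    "('g, 'm) monoid_scheme \<Rightarrow> ('i, 'v::real_normed_vector) cone_diagram \<Rightarrow>
     ('i \<Rightarrow> 'g \<Rightarrow> 'i) \<Rightarrow> ('g \<Rightarrow> 'i \<Rightarrow> 'v \<Rightarrow> 'v) \<Rightarrow> 'i set \<Rightarrow> ('i, 'v) cone_diagram" where
  "stratified_quotient G X dot L J =
     \<lparr>idx = J, cones = cones X,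
      incls = {(i, j, M \<circ> L \<gamma> i) | i j M \<gamma>.
                 i \<in> J \<and> j \<in> J \<and> \<gamma> \<in> carrier G \<and> (dot i \<gamma>, j, M) \<in> face_incls X}\<rparr>"

text \<open>
  \<open>f\<close> sends each cone to its orbit representative via any of the maps \<open>L\<^sub>\<gamma>\<^sub>,\<^sub>i\<close> that lead there. This
  determines \<open>f\<close> on the space of \<open>X\<close>; the existence of such an \<open>f\<close> includes independence of the
  choice of \<open>\<gamma>\<close>.
\<close>

definition is_stratified_projection ::
    "('g, 'm) monoid_scheme \<Rightarrow> ('i, 'v::real_normed_vector) cone_diagram \<Rightarrow>
     ('i \<Rightarrow> 'g \<Rightarrow> 'i) \<Rightarrow> ('g \<Rightarrow> 'i \<Rightarrow> 'v \<Rightarrow> 'v) \<Rightarrow> 'i set \<Rightarrow>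
     (('i \<times> 'v) set \<Rightarrow> ('i \<times> 'v) set) \<Rightarrow> bool" where
  "is_stratified_projection G X dot L J f \<longleftrightarrow>
     (\<forall>i\<in>idx X. \<forall>\<gamma>\<in>carrier G. dot i \<gamma> \<in> J \<longrightarrow>
        (\<forall>x\<in>pts (cones X i).
           f (fan_pt X i x) = fan_pt (stratified_quotient G X dot L J) (dot i \<gamma>) (L \<gamma> i x)))"

end

theory Submission
  imports Defs
begin

text \<open>
  Every inclusion of faces \<open>K\<close> between cones of \<open>J\<close> that covers the action of some group element
  identifies \<open>x\<close> with \<open>K x\<close> in the quotient. Hence sending a point of any cone to a representative
  cone is compatible with the gluing of \<open>X\<close> and independent of the group element chosen; this is the
  projection, and it shows that every point of the quotient lies in some cell. Conversely, points
  identified in the quotient lie in one orbit of \<open>G\<close> on \<open>X\<close>, so the uniqueness of cells in \<open>X\<close> gives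
  uniqueness of the cell in \<open>J\<close>.

  Two facts on cones enter. Lattice-preserving isomorphisms map relative interiors to relative
  interiors; the surrounding normed space may have infinite dimension, so this and the continuity of
  linear maps are established for subsets of a finite-dimensional subspace. Moreover, such isomorphisms
  compose on either side with inclusions of faces, because a linear map that is injective on an ideal
  cone is injective on its span. Inverses of the isomorphisms never occur: as maps of the ambient
  spaces they need not exist.
\<close>

section \<open>Finite-dimensional subspaces of normed spaces\<close>

text \<open>Dividing \<open>w + t *\<^sub>R a\<close> by \<open>t\<close> leaves \<open>a\<close>
  minus a point of \<open>W\<close>. This bounds the \<open>a\<close>-coordinate of a vector by its
  norm as soon as \<open>a\<close> has positive distance from \<open>W\<close>.\<close>

lemma coordinate_bound_by_infdist:
  fixes a :: "'a::real_normed_vector"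
  assumes "subspace W" and w: "w \<in> W"
  shows "\<bar>t\<bar> * infdist a W \<le> norm (w + t *\<^sub>R a)"
proof (cases "t = 0")
  case False
  have "(- 1 / t) *\<^sub>R w \<in> W" by (rule subspace_scale[OF assms])
  then have "infdist a W \<le> norm (a + (1 / t) *\<^sub>R w)"
    using infdist_le[of "(- 1 / t) *\<^sub>R w" W a] by (simp add: dist_norm)
  then have "\<bar>t\<bar> * infdist a W \<le> norm (t *\<^sub>R (a + (1 / t) *\<^sub>R w))"
    by (simp add: mult_left_mono)
  also have "t *\<^sub>R (a + (1 / t) *\<^sub>R w) = w + t *\<^sub>R a"
    using False by (simp add: algebra_simps)
  finally show ?thesis .
qed simp

text \<open>By induction the smaller span is closed, so a new vector \<open>a\<close> has positive
  distance \<open>d\<close> from it. The \<open>a\<close>-coordinates of a convergent sequence are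
  then Cauchy, and subtracting their limit leaves a limit inside the smaller span.\<close>

lemma closed_span_finite:
  fixes B :: "'a::real_normed_vector set"
  assumes "finite B"
  shows "closed (span B)"
  using assms
proof (induction rule: finite_induct)
  case (insert a B)
  show ?case
  proof (cases "a \<in> span B")
    case True
    then show ?thesis using insert by (simp add: span_redundant)
  next
    case False
    define d where "d = infdist a (span B)"
    have "d \<noteq> 0"
      using in_closed_iff_infdist_zero[OF insert.IH, of a] False span_zero[of B]
      by (auto simp: d_def)
    then have d: "d > 0" using infdist_nonneg[of a "span B"] by (simp add: d_def)
    show ?thesis
      unfolding closed_sequential_limits
    proof (intro allI impI, elim conjE)
      fix v :: "nat \<Rightarrow> 'a" and l
      assume v: "\<forall>n. v n \<in> span (insert a B)" and lim: "v \<longlonglongrightarrow> l"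
      obtain t where t: "\<And>n. v n - t n *\<^sub>R a \<in> span B"
        using v unfolding span_breakdown_eq by metis
      have tb: "\<bar>t m - t n\<bar> * d \<le> norm (v m - v n)" for m n
      proof -
        have "(v m - t m *\<^sub>R a) - (v n - t n *\<^sub>R a) \<in> span B"
          by (intro span_diff t)
        from coordinate_bound_by_infdist[OF subspace_span this, of "t m - t n" a]
        show ?thesis by (simp add: d_def algebra_simps)
      qed
      have "Cauchy t"
      proof (rule CauchyI)
        fix e :: real assume "0 < e"
        then have "0 < e * d" using d by simp
        from CauchyD[OF LIMSEQ_imp_Cauchy[OF lim] this]
        obtain M where M: "\<And>m n. m \<ge> M \<Longrightarrow> n \<ge> M \<Longrightarrow> norm (v m - v n) < e * d" by blast
        have "norm (t m - t n) < e" if "m \<ge> M" "n \<ge> M" for m n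
          using le_less_trans[OF tb M[OF that]] d by simp
        then show "\<exists>M. \<forall>m\<ge>M. \<forall>n\<ge>M. norm (t m - t n) < e" by blast
      qed
      then obtain s where s: "t \<longlonglongrightarrow> s"
        using Cauchy_convergent_iff convergent_def by blast
      have "(\<lambda>n. v n - t n *\<^sub>R a) \<longlonglongrightarrow> l - s *\<^sub>R a"
        by (intro tendsto_intros lim s)
      then have "l - s *\<^sub>R a \<in> span B"
        using closed_sequentially[OF insert.IH, of "\<lambda>n. v n - t n *\<^sub>R a"] t by blast
      then show "l \<in> span (insert a B)" unfolding span_breakdown_eq by blast
    qed
  qed
qed simp

text \<open>Induction on the spanning set: splitting off the \<open>a\<close>-coordinate is a
  bounded operation because \<open>a\<close> has positive distance from the closed span of the other
  vectors.\<close>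

lemma linear_bounded_on_span_finite:
  fixes B :: "'a::real_normed_vector set" and f :: "'a \<Rightarrow> 'b::real_normed_vector"
  assumes "finite B" and f: "linear f"
  obtains C where "C > 0" "\<And>x. x \<in> span B \<Longrightarrow> norm (f x) \<le> C * norm x"
proof -
  have "\<exists>C>0. \<forall>x\<in>span B. norm (f x) \<le> C * norm x"
    using assms(1)
  proof (induction rule: finite_induct)
    case empty
    show ?case using linear_0[OF f] by (intro exI[of _ 1]) auto
  next
    case (insert a B)
    show ?case
    proof (cases "a \<in> span B")
      case True
      then show ?thesis using insert by (simp add: span_redundant)
    next
      case False
      define d where "d = infdist a (span B)"
      have "d \<noteq> 0"
        using in_closed_iff_infdist_zero[OF closed_span_finite[OF insert.hyps(1)], of a]
          False span_zero[of B] by (auto simp: d_def)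
      then have d: "d > 0" using infdist_nonneg[of a "span B"] by (simp add: d_def)
      obtain C where C: "C > 0" "\<forall>x\<in>span B. norm (f x) \<le> C * norm x" using insert.IH by blast
      \<comment> \<open>The coordinate of \<open>a\<close> is at most \<open>norm x / d\<close>,
        hence the remainder has norm at most \<open>norm x * (1 + norm a / d)\<close>;
        \<open>C'\<close> adds the resulting bounds for the two images.\<close>
      define C' where "C' = C * (1 + norm a / d) + norm (f a) / d"
      have "norm (f x) \<le> C' * norm x" if x: "x \<in> span (insert a B)" for x
      proof -
        obtain t where t: "x - t *\<^sub>R a \<in> span B" using x unfolding span_breakdown_eq by blast
        have "\<bar>t\<bar> * d \<le> norm x"
          using coordinate_bound_by_infdist[OF subspace_span t, of t a] by (simp add: d_def)
        then have tb: "\<bar>t\<bar> \<le> norm x / d" using d by (simp add: field_simps)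
        have wb: "norm (x - t *\<^sub>R a) \<le> norm x + norm x / d * norm a"
          using norm_triangle_ineq4[of x "t *\<^sub>R a"] mult_right_mono[OF tb norm_ge_zero[of a]] by simp
        have "f x = f (x - t *\<^sub>R a) + t *\<^sub>R f a"
          by (simp add: linear_diff[OF f] linear_scale[OF f])
        then have "norm (f x) \<le> norm (f (x - t *\<^sub>R a)) + \<bar>t\<bar> * norm (f a)"
          by (metis norm_scaleR norm_triangle_ineq)
        also have "\<dots> \<le> C * (norm x + norm x / d * norm a) + norm x / d * norm (f a)"
        proof (intro add_mono)
          have "norm (f (x - t *\<^sub>R a)) \<le> C * norm (x - t *\<^sub>R a)" using C t by blast
          also have "\<dots> \<le> C * (norm x + norm x / d * norm a)"
            using wb C(1) by (intro mult_left_mono) auto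
          finally show "norm (f (x - t *\<^sub>R a)) \<le> C * (norm x + norm x / d * norm a)" .
          show "\<bar>t\<bar> * norm (f a) \<le> norm x / d * norm (f a)"
            using tb by (intro mult_right_mono) auto
        qed
        also have "\<dots> = C' * norm x" by (simp add: C'_def algebra_simps)
        finally show ?thesis .
      qed
      moreover have "C' > 0" using C(1) d by (auto simp: C'_def intro!: add_pos_nonneg mult_pos_pos)
      ultimately show ?thesis by blast
    qed
  qed
  then show thesis using that by blast
qed

lemma linear_continuous_on_span_finite:
  fixes B :: "'a::real_normed_vector set" and f :: "'a \<Rightarrow> 'b::real_normed_vector"
  assumes "finite B" and f: "linear f"
  shows "continuous_on (span B) f"
proof -
  obtain C where C: "C > 0" "\<And>x. x \<in> span B \<Longrightarrow> norm (f x) \<le> C * norm x"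
    using linear_bounded_on_span_finite[OF assms] by blast
  have "C-lipschitz_on (span B) f"
  proof (rule lipschitz_onI)
    fix x y assume "x \<in> span B" "y \<in> span B"
    then show "dist (f x) (f y) \<le> C * dist x y"
      using C(2)[of "x - y"] by (simp add: dist_norm linear_diff[OF f] span_diff)
  qed (use C in simp)
  then show ?thesis by (rule lipschitz_on_continuous_on)
qed


section \<open>Relative interiors\<close>

text \<open>The new point is \<open>x\<close> moved slightly away from \<open>y\<close>, within the
  affine hull and within a ball that meets this hull inside \<open>S\<close>.\<close>

lemma rel_interior_extend:
  fixes S :: "'a::real_normed_vector set"
  assumes x: "x \<in> rel_interior S" and y: "y \<in> S"
  shows "\<exists>e>1. (1 - e) *\<^sub>R y + e *\<^sub>R x \<in> S"
proof -
  obtain r where r: "x \<in> S" "r > 0" "ball x r \<inter> affine hull S \<subseteq> S"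
    using x unfolding mem_rel_interior_ball by blast
  \<comment> \<open>The \<open>2\<close> makes the displacement strictly smaller than
    \<open>r\<close>; the \<open>+ 1\<close> covers the case \<open>x = y\<close>.\<close>
  define t where "t = r / (2 * (norm (x - y) + 1))"
  have t: "t > 0" using r(2) by (simp add: t_def add_nonneg_pos)
  have "t * norm (x - y) < r"
  proof -
    have "t * norm (x - y) \<le> t * (norm (x - y) + 1)" using t by (intro mult_left_mono) auto
    also have "\<dots> = r / 2"
      using norm_ge_zero[of "x - y"] by (simp add: t_def divide_simps del: norm_ge_zero)
    also have "\<dots> < r" using r(2) by simp
    finally show ?thesis .
  qed
  moreover have eq: "(1 - (1 + t)) *\<^sub>R y + (1 + t) *\<^sub>R x = x + t *\<^sub>R (x - y)"
    by (simp add: algebra_simps)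
  ultimately have "(1 - (1 + t)) *\<^sub>R y + (1 + t) *\<^sub>R x \<in> ball x r"
    unfolding eq using t by (simp add: dist_norm)
  moreover have "(1 - (1 + t)) *\<^sub>R y + (1 + t) *\<^sub>R x \<in> affine hull S"
    by (rule mem_affine[OF affine_affine_hull]) (use y r(1) in \<open>auto intro: hull_inc\<close>)
  ultimately have "(1 - (1 + t)) *\<^sub>R y + (1 + t) *\<^sub>R x \<in> S" using r(3) by blast
  then show ?thesis using t by (intro exI[of _ "1 + t"]) auto
qed

text \<open>Converse of \<open>rel_interior_extend\<close> in finite dimension. Along each vector of
  a basis taken from \<open>S\<close> translated by \<open>- x\<close>, a short segment around
  \<open>x\<close> lies in \<open>S\<close>. A point near \<open>x\<close> is the average of points
  on these segments, so convexity puts it in \<open>S\<close>.\<close>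

lemma mem_rel_interior_if_extend:
  fixes S :: "'a::real_normed_vector set"
  assumes S: "convex S" "S \<subseteq> span B" "finite B" and x: "x \<in> S"
    and ext: "\<And>y. y \<in> S \<Longrightarrow> \<exists>e>1. (1 - e) *\<^sub>R y + e *\<^sub>R x \<in> S"
  shows "x \<in> rel_interior S"
proof -
  define D0 where "D0 = (\<lambda>y. - x + y) ` S"
  obtain D where D: "D \<subseteq> D0" "independent D" "D0 \<subseteq> span D"
    using maximal_independent_subset by blast
  have "D0 \<subseteq> span B" using S(2) x by (auto simp: D0_def intro!: span_diff)
  then have finD: "finite D" using independent_span_bound[OF S(3) D(2)] D(1) by blast
  \<comment> \<open>The \<open>g d\<close> are the coordinate functionals dual to the basis
    \<open>D\<close>, extended to the whole space.\<close>
  have "\<exists>g. \<forall>d\<in>D. linear (g d) \<and> (\<forall>b\<in>D. g d b = (if b = d then 1 else 0 :: real))"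
    by (intro bchoice ballI linear_independent_extend D(2))
  then obtain g :: "'a \<Rightarrow> 'a \<Rightarrow> real"
    where g: "\<And>d. d \<in> D \<Longrightarrow> linear (g d)"
      "\<And>d b. d \<in> D \<Longrightarrow> b \<in> D \<Longrightarrow> g d b = (if b = d then 1 else 0)" by blast
  have repr: "(\<Sum>d\<in>D. g d v *\<^sub>R d) = v" if "v \<in> span D" for v
  proof (rule linear_eq_on[OF _ _ that])
    show "linear (\<lambda>v. \<Sum>d\<in>D. g d v *\<^sub>R d)"
      by (intro linear_compose_sum ballI linearI)
        (simp_all add: linear_add[OF g(1)] linear_scale[OF g(1)] scaleR_add_left)
    show "linear (\<lambda>v::'a. v)" by (rule linear_ident)
    fix b assume "b \<in> D"
    then have "(\<Sum>d\<in>D. g d b *\<^sub>R d) = (\<Sum>d\<in>D. if d = b then b else 0)"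
      by (intro sum.cong) (auto simp: g(2))
    then show "(\<Sum>d\<in>D. g d b *\<^sub>R d) = b" using finD \<open>b \<in> D\<close> by simp
  qed
  define n where "n = real (card D)"
  have "eventually (\<lambda>r. \<forall>d\<in>D. \<forall>v\<in>span D. norm v < r \<longrightarrow> x + (n * g d v) *\<^sub>R d \<in> S) (at_right 0)"
  proof (rule eventually_ball_finite[OF finD], rule ballI)
    fix d assume d: "d \<in> D"
    then have xd: "x + d \<in> S" using D(1) by (auto simp: D0_def)
    obtain e where e: "e > 1" "(1 - e) *\<^sub>R (x + d) + e *\<^sub>R x \<in> S" using ext[OF xd] by blast
    then have xe: "x + (1 - e) *\<^sub>R d \<in> S" by (simp add: algebra_simps)
    have comb: "(1 - u) *\<^sub>R (x + d) + u *\<^sub>R (x + w *\<^sub>R d) = x + (1 - u + u * w) *\<^sub>R d" for u w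
      by (simp add: algebra_simps)
    have seg: "x + t *\<^sub>R d \<in> S" if t: "1 - e \<le> t" "t \<le> 1" for t
    proof -
      \<comment> \<open>The endpoints have parameters \<open>1\<close> and \<open>1 - e\<close>, at
        distance \<open>e\<close>, so parameter \<open>t\<close> is reached with weight
        \<open>(1 - t) / e\<close> on the second one.\<close>
      have "(1 - (1 - t) / e) *\<^sub>R (x + d) + ((1 - t) / e) *\<^sub>R (x + (1 - e) *\<^sub>R d) \<in> S"
        using t e(1) by (intro convexD[OF S(1) xd xe]) (auto simp: field_simps)
      also have "(1 - (1 - t) / e) *\<^sub>R (x + d) + ((1 - t) / e) *\<^sub>R (x + (1 - e) *\<^sub>R d)
          = x + (1 - (1 - t) / e + (1 - t) / e * (1 - e)) *\<^sub>R d"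
        by (rule comb)
      also have "1 - (1 - t) / e + (1 - t) / e * (1 - e) = t"
        using e(1) by (simp add: field_simps)
      finally show ?thesis .
    qed
    obtain C where C: "C > 0" "\<And>v. v \<in> span D \<Longrightarrow> norm (g d v) \<le> C * norm v"
      using linear_bounded_on_span_finite[OF finD g(1)[OF d]] by blast
    have n: "n > 0" using d finD by (auto simp: n_def card_gt_0_iff)
    \<comment> \<open>For \<open>norm v < r0\<close> the parameter \<open>n * g d v\<close> has
      absolute value at most \<open>min 1 (e - 1)\<close>, hence stays in the range covered by
      \<open>seg\<close>.\<close>
    define r0 where "r0 = min 1 (e - 1) / (n * C)"
    have "r0 > 0" using e(1) n C(1) by (simp add: r0_def)
    moreover have "x + (n * g d v) *\<^sub>R d \<in> S" if "r < r0" "v \<in> span D" "norm v < r" for r v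
    proof -
      have "\<bar>n * g d v\<bar> \<le> n * (C * norm v)"
        using C(2)[OF that(2)] n by (simp add: abs_mult)
      also have "\<dots> \<le> n * C * r0"
        using that n C(1) by (simp add: mult.assoc)
      also have "\<dots> = min 1 (e - 1)" using n C(1) by (simp add: r0_def)
      finally show ?thesis by (intro seg) auto
    qed
    ultimately show "eventually (\<lambda>r. \<forall>v\<in>span D. norm v < r \<longrightarrow> x + (n * g d v) *\<^sub>R d \<in> S) (at_right 0)"
      unfolding eventually_at_right_field by blast
  qed
  then obtain r where r: "r > 0"
    "\<And>d v. d \<in> D \<Longrightarrow> v \<in> span D \<Longrightarrow> norm v < r \<Longrightarrow> x + (n * g d v) *\<^sub>R d \<in> S"
    unfolding eventually_at_right_field using dense[of "0::real"] by metis
  have "ball x r \<inter> affine hull S \<subseteq> S"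
  proof
    fix z assume z: "z \<in> ball x r \<inter> affine hull S"
    have "affine hull S = (\<lambda>v. x + v) ` span D0"
      unfolding D0_def by (rule affine_hull_span_gen) (use x in \<open>auto intro: hull_inc\<close>)
    then obtain v where v: "z = x + v" "v \<in> span D0" using z by auto
    then have vD: "v \<in> span D" using span_minimal[OF D(3) subspace_span] by blast
    have nv: "norm v < r" using z v(1) by (simp add: dist_norm)
    show "z \<in> S"
    proof (cases "D = {}")
      case True
      then show ?thesis using vD v(1) x by simp
    next
      case False
      then have n: "n > 0" using finD by (simp add: n_def card_gt_0_iff)
      \<comment> \<open>The factor \<open>n\<close> in front of each coordinate cancels the weight
        \<open>1 / n\<close>, so the average is \<open>x + v\<close>.\<close>
      have "(\<Sum>d\<in>D. (1 / n) *\<^sub>R (x + (n * g d v) *\<^sub>R d)) \<in> S"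
        using n by (intro convex_sum[OF finD S(1)] r(2) vD nv) (auto simp: n_def)
      also have "(\<Sum>d\<in>D. (1 / n) *\<^sub>R (x + (n * g d v) *\<^sub>R d)) = (\<Sum>d\<in>D. (1 / n) *\<^sub>R x + g d v *\<^sub>R d)"
        using n by (intro sum.cong) (auto simp: scaleR_add_right)
      also have "\<dots> = (\<Sum>d\<in>D. (1 / n) *\<^sub>R x) + (\<Sum>d\<in>D. g d v *\<^sub>R d)" by (rule sum.distrib)
      also have "\<dots> = z" using n repr[OF vD] v(1) by (simp add: n_def sum_constant_scaleR)
      finally show ?thesis .
    qed
  qed
  then show ?thesis unfolding mem_rel_interior_ball using r(1) x by blast
qed

text \<open>The barycentre \<open>m\<close> of a maximal affinely independent subset
  \<open>A\<close> is a relative interior point: its coordinates are all \<open>1 / n\<close>, so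
  going slightly past \<open>m\<close> from any point keeps all coordinates nonnegative.\<close>

lemma rel_interior_nonempty_span_finite:
  fixes S :: "'a::real_normed_vector set"
  assumes S: "convex S" "S \<subseteq> span B" "finite B" and ne: "S \<noteq> {}"
  shows "rel_interior S \<noteq> {}"
proof -
  obtain A where A: "A \<subseteq> S" "\<not> affine_dependent A" "affine hull S = affine hull A"
    using affine_basis_exists by blast
  then obtain a where a: "a \<in> A" using ne by (cases "A = {}") auto
  have "independent ((\<lambda>x. - a + x) ` (A - {a}))"
    using A(2) affine_dependent_iff_dependent2[OF a] by blast
  moreover have "(\<lambda>x. - a + x) ` (A - {a}) \<subseteq> span B"
    using A(1) S(2) a by (auto intro!: span_diff)
  ultimately have "finite ((\<lambda>x. - a + x) ` (A - {a}))"
    using independent_span_bound[OF S(3)] by blast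
  then have finA: "finite A" by (auto dest!: finite_imageD simp: inj_on_def)
  define n where "n = real (card A)"
  have n: "n > 0" using a finA by (auto simp: n_def card_gt_0_iff)
  define m where "m = (\<Sum>b\<in>A. (1 / n) *\<^sub>R b)"
  have "m \<in> S"
    unfolding m_def using n A(1) by (intro convex_sum[OF finA S(1)]) (auto simp: n_def)
  moreover have "\<exists>e>1. (1 - e) *\<^sub>R y + e *\<^sub>R m \<in> S" if y: "y \<in> S" for y
  proof -
    have "y \<in> affine hull A" using y A(3) hull_inc[of y S affine] by simp
    then obtain u where u: "sum u A = 1" "(\<Sum>v\<in>A. u v *\<^sub>R v) = y"
      unfolding affine_hull_finite[OF finA] by blast
    \<comment> \<open>This makes \<open>t * u v\<close> at most \<open>1 / n\<close> for every
      coordinate \<open>u v\<close> of \<open>y\<close>; the summand \<open>1\<close> keeps the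
      denominator positive.\<close>
    define t where "t = 1 / (n * (1 + (\<Sum>v\<in>A. \<bar>u v\<bar>)))"
    have pos: "1 + (\<Sum>v\<in>A. \<bar>u v\<bar>) > 0" by (intro add_pos_nonneg sum_nonneg) auto
    have t: "t > 0" using n pos by (simp add: t_def)
    have tu: "t * u v \<le> 1 / n" if v: "v \<in> A" for v
    proof -
      have "u v \<le> 1 + (\<Sum>v\<in>A. \<bar>u v\<bar>)"
        using member_le_sum[of v A "\<lambda>v. \<bar>u v\<bar>"] v finA by auto
      then have "t * u v \<le> t * (1 + (\<Sum>v\<in>A. \<bar>u v\<bar>))" using t by (intro mult_left_mono) auto
      also have "\<dots> = 1 / n" using n pos by (simp add: t_def)
      finally show ?thesis .
    qed
    \<comment> \<open>These are the affine coordinates, with respect to \<open>A\<close>, of the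
      point beyond \<open>m\<close> on the line from \<open>y\<close>.\<close>
    have "(\<Sum>v\<in>A. (- t * u v + (1 + t) / n) *\<^sub>R v) \<in> S"
    proof (rule convex_sum[OF finA S(1)])
      show "(\<Sum>v\<in>A. - t * u v + (1 + t) / n) = 1"
        using u(1) n by (simp add: sum.distrib sum_negf sum_subtractf sum_distrib_left[symmetric] n_def)
      show "- t * u v + (1 + t) / n \<ge> 0" if "v \<in> A" for v
      proof -
        have "t / n > 0" using t n by simp
        then show ?thesis using tu[OF that] by (simp add: add_divide_distrib)
      qed
    qed (use A(1) in auto)
    also have "(\<Sum>v\<in>A. (- t * u v + (1 + t) / n) *\<^sub>R v)
        = (1 - (1 + t)) *\<^sub>R (\<Sum>v\<in>A. u v *\<^sub>R v) + (1 + t) *\<^sub>R m"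
      unfolding m_def scaleR_sum_right sum.distrib[symmetric]
      by (intro sum.cong) (auto simp: scaleR_add_left scaleR_left_diff_distrib)
    finally show ?thesis using u(2) t by (intro exI[of _ "1 + t"]) auto
  qed
  ultimately show ?thesis using mem_rel_interior_if_extend[OF S, of m] by blast
qed

text \<open>The extension property that characterises relative interior points involves only affine
  combinations, which a linear map preserves.\<close>

lemma rel_interior_linear_image_span_finite:
  fixes S :: "'a::real_normed_vector set" and f :: "'a \<Rightarrow> 'b::real_normed_vector"
  assumes S: "convex S" "S \<subseteq> span B" "finite B" and f: "linear f"
    and x: "x \<in> rel_interior S"
  shows "f x \<in> rel_interior (f ` S)"
proof (rule mem_rel_interior_if_extend)
  show "convex (f ` S)" by (rule convex_linear_image[OF f S(1)])
  show "f ` S \<subseteq> span (f ` B)" using S(2) by (auto simp: linear_span_image[OF f])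
  show "finite (f ` B)" using S(3) by simp
  show "f x \<in> f ` S" using x rel_interior_subset by blast
  fix z assume "z \<in> f ` S"
  then obtain y where y: "y \<in> S" "z = f y" by blast
  obtain e where e: "e > 1" "(1 - e) *\<^sub>R y + e *\<^sub>R x \<in> S" using rel_interior_extend[OF x y(1)] by blast
  have "f ((1 - e) *\<^sub>R y + e *\<^sub>R x) = (1 - e) *\<^sub>R z + e *\<^sub>R f x"
    by (simp add: y(2) linear_add[OF f] linear_scale[OF f])
  then show "\<exists>e>1. (1 - e) *\<^sub>R z + e *\<^sub>R f x \<in> f ` S" using e by (metis imageI)
qed


section \<open>Lattice-preserving maps of ideal cones\<close>

lemma rational_polyhedral_cone_closed:
  assumes "rational_polyhedral_cone N C"
  shows "0 \<in> C" and "\<And>x y. x \<in> C \<Longrightarrow> y \<in> C \<Longrightarrow> x + y \<in> C"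
    and "\<And>x t. x \<in> C \<Longrightarrow> t \<ge> 0 \<Longrightarrow> t *\<^sub>R x \<in> C" and "convex C"
proof -
  obtain S where C: "C = {\<Sum>x\<in>S. c x *\<^sub>R x | c. \<forall>x\<in>S. 0 \<le> c x}"
    using assms unfolding rational_polyhedral_cone_def by blast
  have memI: "(\<Sum>x\<in>S. c x *\<^sub>R x) \<in> C" if "\<forall>x\<in>S. 0 \<le> c x" for c
    unfolding C using that by blast
  show "0 \<in> C" using memI[of "\<lambda>_. 0"] by simp
  show add: "x + y \<in> C" if "x \<in> C" "y \<in> C" for x y
  proof -
    obtain c d where "x = (\<Sum>v\<in>S. c v *\<^sub>R v)" "\<forall>v\<in>S. 0 \<le> c v"
      "y = (\<Sum>v\<in>S. d v *\<^sub>R v)" "\<forall>v\<in>S. 0 \<le> d v"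
      using \<open>x \<in> C\<close> \<open>y \<in> C\<close> unfolding C by blast
    then show ?thesis using memI[of "\<lambda>v. c v + d v"] by (simp add: scaleR_add_left sum.distrib)
  qed
  show scale: "t *\<^sub>R x \<in> C" if "x \<in> C" "t \<ge> 0" for x t
  proof -
    obtain c where "x = (\<Sum>v\<in>S. c v *\<^sub>R v)" "\<forall>v\<in>S. 0 \<le> c v"
      using \<open>x \<in> C\<close> unfolding C by blast
    then show ?thesis using memI[of "\<lambda>v. t * c v"] that(2) by (simp add: scaleR_sum_right)
  qed
  show "convex C" by (intro convexI add scale)
qed

lemma rational_polyhedral_cone_subset_span:
  assumes "rational_polyhedral_cone N C"
  shows "C \<subseteq> span N"
proof
  fix x assume "x \<in> C"
  then obtain S c where "S \<subseteq> N" "x = (\<Sum>v\<in>S. c v *\<^sub>R v)"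
    using assms unfolding rational_polyhedral_cone_def by blast
  then show "x \<in> span N" by (auto intro!: span_sum span_scale intro: span_base)
qed

text \<open>The differences already form a subspace, because the cone is closed under addition and
  nonnegative scaling; a negative scalar exchanges the two terms.\<close>

lemma span_rational_polyhedral_cone:
  assumes "rational_polyhedral_cone N C"
  shows "span C = {x - y | x y. x \<in> C \<and> y \<in> C}"
proof
  note cl = rational_polyhedral_cone_closed[OF assms]
  have "subspace {x - y | x y. x \<in> C \<and> y \<in> C}"
  proof (rule subspaceI)
    show "0 \<in> {x - y | x y. x \<in> C \<and> y \<in> C}" using cl(1) by force
    fix u v assume "u \<in> {x - y | x y. x \<in> C \<and> y \<in> C}" "v \<in> {x - y | x y. x \<in> C \<and> y \<in> C}"
    then obtain x y x' y' where "u = x - y" "v = x' - y'" "x \<in> C" "y \<in> C" "x' \<in> C" "y' \<in> C" by blast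
    then have "u + v = (x + x') - (y + y')" "x + x' \<in> C" "y + y' \<in> C" by (auto intro: cl(2))
    then show "u + v \<in> {x - y | x y. x \<in> C \<and> y \<in> C}" by blast
  next
    fix t u assume "u \<in> {x - y | x y. x \<in> C \<and> y \<in> C}"
    then obtain x y where u: "u = x - y" "x \<in> C" "y \<in> C" by blast
    show "t *\<^sub>R u \<in> {x - y | x y. x \<in> C \<and> y \<in> C}"
    proof (cases "t \<ge> 0")
      case True
      then have "t *\<^sub>R u = t *\<^sub>R x - t *\<^sub>R y" "t *\<^sub>R x \<in> C" "t *\<^sub>R y \<in> C"
        using u by (auto intro: cl(3) simp: scaleR_right_diff_distrib)
      then show ?thesis by blast
    next
      case False
      then have "t *\<^sub>R u = (- t) *\<^sub>R y - (- t) *\<^sub>R x" "(- t) *\<^sub>R x \<in> C" "(- t) *\<^sub>R y \<in> C"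
        using cl(3)[of x "- t"] cl(3)[of y "- t"] u by (simp_all add: scaleR_right_diff_distrib)
      then show ?thesis by blast
    qed
  qed
  moreover have "C \<subseteq> {x - y | x y. x \<in> C \<and> y \<in> C}"
  proof
    fix x assume "x \<in> C"
    then show "x \<in> {x - y | x y. x \<in> C \<and> y \<in> C}"
      using cl(1) by (intro CollectI exI[of _ x] exI[of _ 0]) simp
  qed
  ultimately show "span C \<subseteq> {x - y | x y. x \<in> C \<and> y \<in> C}" by (rule span_minimal[rotated])
  show "{x - y | x y. x \<in> C \<and> y \<in> C} \<subseteq> span C" by (auto intro: span_diff span_base)
qed

lemma ideal_cone_from_subset: "ideal_cone_from N C \<sigma> \<Longrightarrow> \<sigma> \<subseteq> C"
  by (auto simp: ideal_cone_from_def)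

text \<open>A face containing an inner point of a segment of \<open>C\<close> contains its ends. A
  removed face through the midpoint would therefore contain \<open>m\<close>, which was
  kept.\<close>

lemma ideal_cone_from_midpoint:
  assumes "ideal_cone_from N C \<sigma>" and m: "m \<in> \<sigma>" and x: "x \<in> C"
  shows "midpoint x m \<in> \<sigma>"
proof (cases "x = m")
  case False
  obtain \<F> where \<F>: "\<And>F. F \<in> \<F> \<Longrightarrow> F face_of C" "\<sigma> = C - \<Union>\<F>"
    using assms(1) unfolding ideal_cone_from_def by blast
  have "convex C"
    using assms(1) rational_polyhedral_cone_closed(4) unfolding ideal_cone_from_def by blast
  moreover have mC: "m \<in> C" using m ideal_cone_from_subset[OF assms(1)] by blast
  moreover have seg: "midpoint x m \<in> open_segment x m" using False by simp
  ultimately have "midpoint x m \<in> C"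
    using x by (meson convex_contains_open_segment subsetD)
  moreover have "midpoint x m \<notin> F" if "F \<in> \<F>" for F
  proof
    assume "midpoint x m \<in> F"
    then have "m \<in> F" using \<F>(1)[OF that] x mC seg unfolding face_of_def by blast
    then show False using that m \<F>(2) by blast
  qed
  ultimately show ?thesis using \<F>(2) by blast
qed (use m in simp)

text \<open>Taking midpoints with a fixed \<open>m\<close> in the ideal cone moves all of
  \<open>C\<close> into it, so injectivity passes to \<open>C\<close>. Vectors of the span are
  differences of points of \<open>C\<close>, so the kernel meets the span only in
  \<open>0\<close>.\<close>

lemma inj_on_span_ideal_cone:
  assumes cone: "ideal_cone_from N C \<sigma>" and f: "linear f" "inj_on f \<sigma>"
  shows "inj_on f (span C)"
proof -
  have rat: "rational_polyhedral_cone N C" and "\<sigma> \<noteq> {}"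
    using cone unfolding ideal_cone_from_def by auto
  then obtain m where m: "m \<in> \<sigma>" by blast
  have inj: "x = y" if "x \<in> C" "y \<in> C" "f x = f y" for x y
  proof -
    have "f (midpoint x m) = f (midpoint y m)"
      using that(3) by (simp add: midpoint_def linear_add[OF f(1)] linear_scale[OF f(1)])
    then have "midpoint x m = midpoint y m"
      using ideal_cone_from_midpoint[OF cone m] that(1,2) by (intro inj_onD[OF f(2)]) auto
    then show ?thesis by (simp add: midpoint_def)
  qed
  have "v = 0" if "v \<in> span C" "f v = 0" for v
  proof -
    obtain x y where v: "v = x - y" "x \<in> C" "y \<in> C"
      using \<open>v \<in> span C\<close> unfolding span_rational_polyhedral_cone[OF rat] by blast
    then have "f x = f y" using \<open>f v = 0\<close> by (simp add: linear_diff[OF f(1)])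
    then show ?thesis using inj v by simp
  qed
  then show ?thesis using linear_inj_on_iff_eq_0[OF f(1) subspace_span] by blast
qed

section \<open>Linear images of cones and faces\<close>

text \<open>Injectivity on \<open>C\<close> forces the preimage of a point of an open segment to lie
  on the open segment between the preimages of the ends.\<close>

lemma face_of_linear_image_inj_on:
  assumes f: "linear f" "inj_on f C" and C: "convex C" and F: "F face_of C"
  shows "f ` F face_of f ` C"
  unfolding face_of_def
proof (intro conjI ballI impI)
  have FC: "F \<subseteq> C" "convex F" using F by (auto simp: face_of_def)
  then show "f ` F \<subseteq> f ` C" "convex (f ` F)" by (auto intro: convex_linear_image[OF f(1)])
  fix a b x assume a: "a \<in> f ` C" and b: "b \<in> f ` C" and x: "x \<in> f ` F" "x \<in> open_segment a b"
  obtain a' b' x' where *: "a = f a'" "a' \<in> C" "b = f b'" "b' \<in> C" "x = f x'" "x' \<in> F"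
    using a b x(1) by blast
  obtain u where u: "a \<noteq> b" "0 < u" "u < 1" "x = (1 - u) *\<^sub>R a + u *\<^sub>R b"
    using x(2) unfolding in_segment by blast
  have "x = f ((1 - u) *\<^sub>R a' + u *\<^sub>R b')"
    by (simp add: u(4) * linear_add[OF f(1)] linear_scale[OF f(1)])
  moreover have "(1 - u) *\<^sub>R a' + u *\<^sub>R b' \<in> C" using u * by (intro convexD[OF C]) auto
  ultimately have "x' = (1 - u) *\<^sub>R a' + u *\<^sub>R b'"
    using * FC(1) by (intro inj_onD[OF f(2)]) auto
  then have "x' \<in> open_segment a' b'" using u * by (auto simp: in_segment)
  then have "a' \<in> F" "b' \<in> F" using F * unfolding face_of_def by blast+
  then show "a \<in> f ` F" "b \<in> f ` F" using * by auto
qed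

lemma rational_polyhedral_cone_linear_image:
  assumes "rational_polyhedral_cone N C" and f: "linear f" and N': "f ` N \<subseteq> N'"
  shows "rational_polyhedral_cone N' (f ` C)"
proof -
  obtain S where S: "finite S" "S \<subseteq> N" and C: "C = {\<Sum>x\<in>S. c x *\<^sub>R x | c. \<forall>x\<in>S. 0 \<le> c x}"
    using assms(1) unfolding rational_polyhedral_cone_def by blast
  have "f ` C = {\<Sum>y\<in>f ` S. d y *\<^sub>R y | d. \<forall>y\<in>f ` S. 0 \<le> d y}"
  proof (intro equalityI subsetI)
    fix z assume "z \<in> f ` C"
    then obtain c where c: "\<forall>x\<in>S. 0 \<le> c x" "z = f (\<Sum>x\<in>S. c x *\<^sub>R x)" unfolding C by blast
    \<comment> \<open>Several generators may have the same image, so coefficients are added over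
      each fibre.\<close>
    define d where "d y = (\<Sum>x\<in>{x\<in>S. f x = y}. c x)" for y
    have "z = (\<Sum>x\<in>S. c x *\<^sub>R f x)"
      by (simp add: c(2) linear_sum[OF f] linear_scale[OF f])
    also have "\<dots> = (\<Sum>y\<in>f ` S. \<Sum>x\<in>{x\<in>S. f x = y}. c x *\<^sub>R f x)"
      by (rule sum.image_gen[OF S(1)])
    also have "\<dots> = (\<Sum>y\<in>f ` S. d y *\<^sub>R y)"
      by (simp add: d_def scaleR_sum_left)
    finally have "z = (\<Sum>y\<in>f ` S. d y *\<^sub>R y)" .
    moreover have "\<forall>y\<in>f ` S. 0 \<le> d y" using c(1) by (auto simp: d_def intro: sum_nonneg)
    ultimately show "z \<in> {\<Sum>y\<in>f ` S. d y *\<^sub>R y | d. \<forall>y\<in>f ` S. 0 \<le> d y}" by blast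
  next
    fix z assume "z \<in> {\<Sum>y\<in>f ` S. d y *\<^sub>R y | d. \<forall>y\<in>f ` S. 0 \<le> d y}"
    then obtain d where d: "\<forall>y\<in>f ` S. 0 \<le> d y" "z = (\<Sum>y\<in>f ` S. d y *\<^sub>R y)" by blast
    \<comment> \<open>\<open>T\<close> picks one generator from each fibre; in \<open>c\<close> it
      carries the whole coefficient and the other generators get \<open>0\<close>.\<close>
    obtain T where T: "T \<subseteq> S" "inj_on f T" "f ` S = f ` T"
      by (metis subset_image_inj subset_refl)
    define c where "c x = (if x \<in> T then d (f x) else 0)" for x
    have "z = (\<Sum>x\<in>T. d (f x) *\<^sub>R f x)" by (simp add: d(2) T(3) sum.reindex[OF T(2)])
    also have "\<dots> = (\<Sum>x\<in>S. c x *\<^sub>R f x)"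
      using S(1) T(1) by (intro sum.mono_neutral_cong_left) (auto simp: c_def)
    also have "\<dots> = f (\<Sum>x\<in>S. c x *\<^sub>R x)"
      by (simp add: linear_sum[OF f] linear_scale[OF f])
    finally have "z = f (\<Sum>x\<in>S. c x *\<^sub>R x)" .
    moreover have "\<forall>x\<in>S. 0 \<le> c x" using d(1) by (auto simp: c_def)
    ultimately show "z \<in> f ` C" unfolding C by blast
  qed
  moreover have "finite (f ` S)" "f ` S \<subseteq> N'" using S N' by auto
  ultimately show ?thesis unfolding rational_polyhedral_cone_def by blast
qed

text \<open>Injectivity extends from the ideal cone to \<open>C\<close>, so taking images commutes
  with removing faces.\<close>

lemma ideal_cone_from_linear_image:
  assumes cone: "ideal_cone_from N C \<sigma>" and f: "linear f" "inj_on f \<sigma>" and N': "f ` N \<subseteq> N'"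
  shows "ideal_cone_from N' (f ` C) (f ` \<sigma>)"
proof -
  have inj: "inj_on f C"
    using inj_on_span_ideal_cone[OF cone f] span_superset inj_on_subset by blast
  obtain \<F> where \<F>: "\<And>F. F \<in> \<F> \<Longrightarrow> F face_of C" "\<sigma> = C - \<Union>\<F>"
    and rat: "rational_polyhedral_cone N C" and conv: "convex \<sigma>" and ne: "\<sigma> \<noteq> {}"
    using cone unfolding ideal_cone_from_def by blast
  have "f ` \<sigma> = f ` C - \<Union> ((`) f ` \<F>)"
  proof -
    have "F \<subseteq> C" if "F \<in> \<F>" for F using \<F>(1)[OF that] by (simp add: face_of_imp_subset)
    then have "f ` \<sigma> = f ` C - f ` \<Union>\<F>"
      unfolding \<F>(2) by (intro inj_on_image_set_diff[OF inj]) auto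
    then show ?thesis by (simp add: image_Union)
  qed
  moreover have "F face_of f ` C" if F: "F \<in> (`) f ` \<F>" for F
  proof -
    obtain F' where "F = f ` F'" "F' \<in> \<F>" using F by blast
    then show ?thesis
      using face_of_linear_image_inj_on[OF f(1) inj rational_polyhedral_cone_closed(4)[OF rat] \<F>(1)]
      by simp
  qed
  ultimately show ?thesis
    unfolding ideal_cone_from_def
    using rational_polyhedral_cone_linear_image[OF rat f(1) N'] convex_linear_image[OF f(1) conv] ne
    by blast
qed

lemma ideal_cone_face_linear_image:
  assumes "ideal_cone_face N T \<sigma>" and f: "linear f" "inj_on f \<sigma>" and N': "f ` N \<subseteq> N'"
  shows "ideal_cone_face N' (f ` T) (f ` \<sigma>)"
proof -
  obtain C F where cone: "ideal_cone_from N C \<sigma>" and F: "F face_of C" "T = \<sigma> \<inter> F"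
    using assms(1) unfolding ideal_cone_face_def by blast
  have inj: "inj_on f C"
    using inj_on_span_ideal_cone[OF cone f] span_superset inj_on_subset by blast
  have "convex C"
    using cone rational_polyhedral_cone_closed(4) unfolding ideal_cone_from_def by blast
  then have "f ` F face_of f ` C" by (rule face_of_linear_image_inj_on[OF f(1) inj _ F(1)])
  moreover have "f ` T = f ` \<sigma> \<inter> f ` F"
    unfolding F(2) using ideal_cone_from_subset[OF cone] face_of_imp_subset[OF F(1)]
    by (rule inj_on_image_Int[OF inj])
  ultimately show ?thesis
    unfolding ideal_cone_face_def using ideal_cone_from_linear_image[OF cone f N'] by blast
qed

section \<open>Composition of lattice-preserving maps\<close>

lemma lattice_preserving_inclusion_pts:
  "lattice_preserving_inclusion c d f \<Longrightarrow> x \<in> pts c \<Longrightarrow> f x \<in> pts d"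
  by (auto simp: lattice_preserving_inclusion_def ideal_cone_face_def)

lemma lattice_preserving_isomorphism_id:
  assumes "ideal_cone c"
  shows "lattice_preserving_isomorphism c c id"
proof -
  obtain C where C: "ideal_cone_from (lat c) C (pts c)" using assms unfolding ideal_cone_def by blast
  then have "C face_of C"
    using rational_polyhedral_cone_closed(4) face_of_refl unfolding ideal_cone_from_def by blast
  then have "ideal_cone_face (lat c) (pts c) (pts c)"
    unfolding ideal_cone_face_def using C ideal_cone_from_subset[OF C] by blast
  then show ?thesis
    by (simp add: lattice_preserving_isomorphism_def lattice_preserving_inclusion_def
        integral_linear_def linear_id[unfolded id_def[symmetric]])
qed

lemma integral_linear_compose:
  "integral_linear c d f \<Longrightarrow> integral_linear d e g \<Longrightarrow> integral_linear c e (g \<circ> f)"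
  unfolding integral_linear_def by (fastforce intro: linear_compose)

text \<open>The isomorphism maps cone onto cone and span onto span, so the face condition and the
  lattice condition of the composite are those of \<open>g\<close>.\<close>

lemma lattice_preserving_inclusion_compose_isomorphism:
  assumes f: "lattice_preserving_isomorphism c d f" and g: "lattice_preserving_inclusion d e g"
  shows "lattice_preserving_inclusion c e (g \<circ> f)"
  unfolding lattice_preserving_inclusion_def
proof (intro conjI)
  have f': "integral_linear c d f" "inj_on f (pts c)" "f ` pts c = pts d"
    "f ` (lat c \<inter> span (pts c)) = lat d \<inter> f ` span (pts c)"
    using f by (auto simp: lattice_preserving_isomorphism_def lattice_preserving_inclusion_def)
  have g': "integral_linear d e g" "inj_on g (pts d)" "ideal_cone_face (lat e) (g ` pts d) (pts e)"
    "g ` (lat d \<inter> span (pts d)) = lat e \<inter> g ` span (pts d)"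
    using g by (auto simp: lattice_preserving_inclusion_def)
  show "integral_linear c e (g \<circ> f)" by (rule integral_linear_compose[OF f'(1) g'(1)])
  show "inj_on (g \<circ> f) (pts c)" using f' g' by (simp add: comp_inj_on)
  show "ideal_cone_face (lat e) ((g \<circ> f) ` pts c) (pts e)"
    using g'(3) unfolding image_comp[symmetric] f'(3) .
  have "f ` span (pts c) = span (pts d)"
    using f'(1,3) by (simp add: integral_linear_def linear_span_image[symmetric])
  then show "(g \<circ> f) ` (lat c \<inter> span (pts c)) = lat e \<inter> (g \<circ> f) ` span (pts c)"
    unfolding image_comp[symmetric] f'(4) by (simp add: g'(4))
qed

text \<open>Here \<open>g\<close> has to carry a face and the lattice points of its span. It does so
  because it is injective on the span of the larger cone.\<close>

lemma lattice_preserving_isomorphism_compose_inclusion: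
  assumes f: "lattice_preserving_inclusion c d f" and g: "lattice_preserving_isomorphism d e g"
  shows "lattice_preserving_inclusion c e (g \<circ> f)"
  unfolding lattice_preserving_inclusion_def
proof (intro conjI)
  have f': "integral_linear c d f" "inj_on f (pts c)" "ideal_cone_face (lat d) (f ` pts c) (pts d)"
    "f ` (lat c \<inter> span (pts c)) = lat d \<inter> f ` span (pts c)"
    using f by (auto simp: lattice_preserving_inclusion_def)
  have g': "integral_linear d e g" "inj_on g (pts d)" "g ` pts d = pts e"
    "g ` (lat d \<inter> span (pts d)) = lat e \<inter> g ` span (pts d)"
    using g by (auto simp: lattice_preserving_isomorphism_def lattice_preserving_inclusion_def)
  have lin: "linear f" "linear g" "g ` lat d \<subseteq> lat e"
    using f'(1) g'(1) by (auto simp: integral_linear_def)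
  have fpts: "f ` pts c \<subseteq> pts d" using lattice_preserving_inclusion_pts[OF f] by blast
  show "integral_linear c e (g \<circ> f)" by (rule integral_linear_compose[OF f'(1) g'(1)])
  show "inj_on (g \<circ> f) (pts c)"
    by (rule comp_inj_on[OF f'(2) inj_on_subset[OF g'(2) fpts]])
  show "ideal_cone_face (lat e) ((g \<circ> f) ` pts c) (pts e)"
    using ideal_cone_face_linear_image[OF f'(3) lin(2) g'(2) lin(3)]
    unfolding image_comp[symmetric] g'(3) .
  obtain C where "ideal_cone_from (lat d) C (pts d)"
    using f'(3) unfolding ideal_cone_face_def by blast
  then have inj: "inj_on g (span (pts d))"
    using inj_on_span_ideal_cone[OF _ lin(2) g'(2)] ideal_cone_from_subset
    by (meson inj_on_subset span_mono)
  have sub: "f ` span (pts c) \<subseteq> span (pts d)"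
    using span_mono[OF fpts] by (simp add: linear_span_image[OF lin(1)])
  have "g ` (lat d \<inter> f ` span (pts c)) = lat e \<inter> g ` (f ` span (pts c))"
  proof (intro equalityI subsetI)
    fix z assume z: "z \<in> lat e \<inter> g ` (f ` span (pts c))"
    then obtain w where w: "w \<in> f ` span (pts c)" "z = g w" by blast
    then have "z \<in> g ` (lat d \<inter> span (pts d))" unfolding g'(4) using z sub by blast
    then obtain v where v: "v \<in> lat d" "v \<in> span (pts d)" "z = g v" by blast
    \<comment> \<open>\<open>v\<close> is a lattice point and \<open>w\<close> lies in the span of
      the face; both belong to \<open>span (pts d)\<close>, where \<open>g\<close> is
      injective.\<close>
    have "v = w" using w v sub by (intro inj_onD[OF inj]) auto
    then show "z \<in> g ` (lat d \<inter> f ` span (pts c))" using v w by blast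
  qed (use lin(3) in blast)
  then show "(g \<circ> f) ` (lat c \<inter> span (pts c)) = lat e \<inter> (g \<circ> f) ` span (pts c)"
    unfolding image_comp[symmetric] f'(4) .
qed

lemma lattice_preserving_isomorphism_compose:
  assumes "lattice_preserving_isomorphism c d f" and "lattice_preserving_isomorphism d e g"
  shows "lattice_preserving_isomorphism c e (g \<circ> f)"
  using lattice_preserving_inclusion_compose_isomorphism[of c d f e g] assms
  unfolding lattice_preserving_isomorphism_def image_comp[symmetric] by simp

section \<open>Relative interiors and continuity for ideal cones\<close>

text \<open>The lattice basis serves as \<open>B\<close>, since the cone is generated by lattice
  vectors. This supplies the assumptions of the lemmas on finite-dimensional subspaces.\<close>

lemma ideal_cone_finite_dimensional:
  fixes c :: "'a::real_vector lattice_cone"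
  assumes "ideal_cone c"
  obtains B where "finite B" "pts c \<subseteq> span B" "convex (pts c)" "pts c \<noteq> {}"
proof -
  obtain B where B: "finite B" "lat c = {\<Sum>b\<in>B. of_int (k b) *\<^sub>R b | k :: 'a \<Rightarrow> int. True}"
    using assms unfolding ideal_cone_def is_lattice_in_def by blast
  have latB: "lat c \<subseteq> span B" unfolding B(2) by (auto intro!: span_sum span_scale intro: span_base)
  obtain C where C: "ideal_cone_from (lat c) C (pts c)" using assms unfolding ideal_cone_def by blast
  have "C \<subseteq> span (lat c)"
    using C rational_polyhedral_cone_subset_span unfolding ideal_cone_from_def by blast
  also have "\<dots> \<subseteq> span B" by (rule span_minimal[OF latB subspace_span])
  finally have "pts c \<subseteq> span B" using ideal_cone_from_subset[OF C] by blast
  then show thesis using that B(1) C unfolding ideal_cone_from_def by blast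
qed

lemma rel_interior_ideal_cone_nonempty:
  fixes c :: "'v::real_normed_vector lattice_cone"
  assumes "ideal_cone c"
  obtains x where "x \<in> rel_interior (pts c)" "x \<in> pts c"
proof -
  obtain B where B: "finite B" "pts c \<subseteq> span B" "convex (pts c)" "pts c \<noteq> {}"
    using ideal_cone_finite_dimensional[OF assms] .
  from rel_interior_nonempty_span_finite[OF B(3,2,1,4)]
  show thesis using that rel_interior_subset[of "pts c"] by blast
qed

lemma lattice_preserving_isomorphism_rel_interior:
  fixes c :: "'v::real_normed_vector lattice_cone" and d :: "'w::real_normed_vector lattice_cone"
  assumes c: "ideal_cone c" and f: "lattice_preserving_isomorphism c d f"
    and x: "x \<in> rel_interior (pts c)"
  shows "f x \<in> rel_interior (pts d)"
proof -
  have lin: "linear f" and im: "f ` pts c = pts d"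
    using f by (auto simp: lattice_preserving_isomorphism_def lattice_preserving_inclusion_def integral_linear_def)
  obtain B where B: "finite B" "pts c \<subseteq> span B" "convex (pts c)"
    using ideal_cone_finite_dimensional[OF c] by blast
  show ?thesis using rel_interior_linear_image_span_finite[OF B(3,2,1) lin x] unfolding im .
qed

lemma continuous_on_ideal_cone:
  fixes c :: "'v::real_normed_vector lattice_cone" and f :: "'v \<Rightarrow> 'w::real_normed_vector"
  assumes c: "ideal_cone c" and f: "linear f"
  shows "continuous_on (pts c) f"
proof -
  obtain B where B: "finite B" "pts c \<subseteq> span B"
    using ideal_cone_finite_dimensional[OF c] by blast
  show ?thesis
    by (rule continuous_on_subset[OF linear_continuous_on_span_finite[OF B(1) f] B(2)])
qed


section \<open>Points of glued spaces\<close>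

lemma topspace_cone_coproduct:
  "topspace (cone_coproduct X) = Sigma (idx X) (\<lambda>i. pts (cones X i))"
  by (auto simp: cone_coproduct_def)

lemma fan_pt_in_topspace:
  "i \<in> idx X \<Longrightarrow> x \<in> pts (cones X i) \<Longrightarrow> fan_pt X i x \<in> topspace (fan_space X)"
  by (auto simp: topspace_fan_space topspace_cone_coproduct fan_pt_def intro: quotientI)

lemma topspace_fan_space_cases:
  assumes "p \<in> topspace (fan_space X)"
  obtains i x where "i \<in> idx X" "x \<in> pts (cones X i)" "p = fan_pt X i x"
  using assms by (auto simp: topspace_fan_space topspace_cone_coproduct fan_pt_def elim!: quotientE)

lemma fan_pt_eq_iff:
  assumes "i \<in> idx X" "x \<in> pts (cones X i)" "j \<in> idx X" "y \<in> pts (cones X j)"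
  shows "fan_pt X i x = fan_pt X j y \<longleftrightarrow> equivclp (basic_glue X) (i, x) (j, y)"
proof -
  have T: "(i, x) \<in> topspace (cone_coproduct X)" "(j, y) \<in> topspace (cone_coproduct X)"
    using assms by (auto simp: topspace_cone_coproduct)
  show ?thesis
    unfolding fan_pt_def eq_equiv_class_iff[OF equiv_glue_rel T] using T by (simp add: glue_rel_def)
qed

lemma fan_pt_self:
  "i \<in> idx X \<Longrightarrow> x \<in> pts (cones X i) \<Longrightarrow> (i, x) \<in> fan_pt X i x"
  unfolding fan_pt_def using equiv_class_self[OF equiv_glue_rel, of "(i, x)" X]
  by (auto simp: topspace_cone_coproduct)

text \<open>The universal properties of the quotient and of the disjoint union reduce continuity to
  the single cones.\<close>

lemma continuous_map_from_fan_space: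
  assumes "\<And>i. i \<in> idx X \<Longrightarrow>
    continuous_map (top_of_set (pts (cones X i))) Y (\<lambda>x. f (fan_pt X i x))"
  shows "continuous_map (fan_space X) Y f"
proof (rule continuous_compose_quotient_map[OF quotient_map_fan_space])
  have "f (fan_pt X i x) \<in> topspace Y" if "i \<in> idx X" "x \<in> pts (cones X i)" for i x
    using continuous_map_image_subset_topspace[OF assms[OF that(1)]] that(2) by auto
  moreover have "openin (cone_coproduct X)
      {p \<in> topspace (cone_coproduct X). (f \<circ> (\<lambda>(i, x). fan_pt X i x)) p \<in> U}"
    if U: "openin Y U" for U
    unfolding cone_coproduct_def openin_sum_topology
  proof (intro conjI ballI)
    fix i assume i: "i \<in> idx X"
    from openin_continuous_map_preimage[OF assms[OF i] U] i
    show "openin (top_of_set (pts (cones X i)))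
        {x. (i, x) \<in> {p \<in> topspace (sum_topology (\<lambda>i. top_of_set (pts (cones X i))) (idx X)).
          (f \<circ> (\<lambda>(i, x). fan_pt X i x)) p \<in> U}}"
      by simp
  qed auto
  ultimately show "continuous_map (cone_coproduct X) Y (f \<circ> (\<lambda>(i, x). fan_pt X i x))"
    by (auto simp: continuous_map topspace_cone_coproduct)
qed

lemma continuous_map_fan_pt:
  assumes "i \<in> idx X"
  shows "continuous_map (top_of_set (pts (cones X i))) (fan_space X) (fan_pt X i)"
proof -
  have "continuous_map (top_of_set (pts (cones X i))) (cone_coproduct X) (Pair i)"
    unfolding cone_coproduct_def by (rule continuous_map_component_injection[OF assms])
  from continuous_map_compose[OF this quotient_imp_continuous_map[OF quotient_map_fan_space]]
  show ?thesis by (simp add: o_def)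
qed

lemma ideal_stacky_fanD:
  assumes "ideal_stacky_fan X"
  shows "i \<in> idx X \<Longrightarrow> ideal_cone (cones X i)"
    and "p \<in> topspace (fan_space X) \<Longrightarrow>
      \<exists>!i. i \<in> idx X \<and> (\<exists>x\<in>rel_interior (pts (cones X i)). fan_pt X i x = p)"
proof -
  note conj = assms[unfolded ideal_stacky_fan_def]
  show "ideal_cone (cones X i)" if "i \<in> idx X"
    using conjunct1[OF conj] that by (rule bspec)
  show "\<exists>!i. i \<in> idx X \<and> (\<exists>x\<in>rel_interior (pts (cones X i)). fan_pt X i x = p)"
    if "p \<in> topspace (fan_space X)"
    using conjunct2[OF conjunct2[OF conj]] that by (rule bspec)
qed

lemma cell_unique:
  assumes "ideal_stacky_fan X" "i \<in> idx X" "j \<in> idx X"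
    and "x \<in> rel_interior (pts (cones X i))" "y \<in> rel_interior (pts (cones X j))"
    and "fan_pt X i x = fan_pt X j y"
  shows "i = j"
proof -
  have "fan_pt X i x \<in> topspace (fan_space X)"
    using assms(2,4) rel_interior_subset by (intro fan_pt_in_topspace) auto
  then have "\<exists>!k. k \<in> idx X \<and> (\<exists>z\<in>rel_interior (pts (cones X k)). fan_pt X k z = fan_pt X i x)"
    by (rule ideal_stacky_fanD(2)[OF assms(1)])
  then show ?thesis using assms(2-6) by metis
qed


section \<open>Admissible actions\<close>

lemma coversD:
  assumes "covers X act \<gamma> i j f"
  shows "j \<in> idx X" "lattice_preserving_isomorphism (cones X i) (cones X j) f"
    "lattice_preserving_inclusion (cones X i) (cones X j) f"
    "\<And>x. x \<in> pts (cones X i) \<Longrightarrow> act \<gamma> (fan_pt X i x) = fan_pt X j (f x)"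
    "f ` pts (cones X i) = pts (cones X j)"
    "\<And>x. x \<in> pts (cones X i) \<Longrightarrow> f x \<in> pts (cones X j)"
  using assms by (auto simp: covers_def lattice_preserving_isomorphism_def)

lemma covers_compose:
  assumes act: "fan_action G X act" and \<gamma>\<delta>: "\<gamma> \<in> carrier G" "\<delta> \<in> carrier G" and i: "i \<in> idx X"
    and f: "covers X act \<gamma> i j f" and g: "covers X act \<delta> j k g"
  shows "covers X act (\<gamma> \<otimes>\<^bsub>G\<^esub> \<delta>) i k (g \<circ> f)"
  unfolding covers_def
proof (intro conjI ballI)
  fix x assume x: "x \<in> pts (cones X i)"
  have "act (\<gamma> \<otimes>\<^bsub>G\<^esub> \<delta>) (fan_pt X i x) = act \<delta> (act \<gamma> (fan_pt X i x))"
    using act \<gamma>\<delta> fan_pt_in_topspace[OF i x] by (simp add: fan_action_def)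
  then show "act (\<gamma> \<otimes>\<^bsub>G\<^esub> \<delta>) (fan_pt X i x) = fan_pt X k ((g \<circ> f) x)"
    using coversD[OF f] coversD[OF g] x by simp
next
  show "k \<in> idx X" by (rule coversD(1)[OF g])
  show "lattice_preserving_isomorphism (cones X i) (cones X k) (g \<circ> f)"
    by (rule lattice_preserving_isomorphism_compose[OF coversD(2)[OF f] coversD(2)[OF g]])
qed

text \<open>Isomorphisms preserve relative interiors. The translate of a relative interior point of
  the \<open>i\<close>-th cone thus lies in the cells of both \<open>j\<close> and \<open>k\<close>,
  and cells are disjoint.\<close>

lemma covers_unique:
  assumes X: "ideal_stacky_fan X" and i: "i \<in> idx X"
    and f: "covers X act \<gamma> i j f" and g: "covers X act \<gamma> i k g"
  shows "j = k"
proof -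
  have c: "ideal_cone (cones X i)" using ideal_stacky_fanD(1)[OF X i] .
  then obtain x where x: "x \<in> rel_interior (pts (cones X i))" "x \<in> pts (cones X i)"
    using rel_interior_ideal_cone_nonempty by blast
  show ?thesis
  proof (rule cell_unique[OF X coversD(1)[OF f] coversD(1)[OF g]])
    show "f x \<in> rel_interior (pts (cones X j))" "g x \<in> rel_interior (pts (cones X k))"
      using lattice_preserving_isomorphism_rel_interior[OF c _ x(1)] coversD(2)[OF f] coversD(2)[OF g]
      by blast+
    show "fan_pt X j (f x) = fan_pt X k (g x)"
      using coversD(4)[OF f x(2)] coversD(4)[OF g x(2)] by simp
  qed
qed

lemma covers_one_id:
  assumes X: "ideal_stacky_fan X" and act: "fan_action G X act" and i: "i \<in> idx X"
  shows "covers X act \<one>\<^bsub>G\<^esub> i i id"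
proof -
  have "ideal_cone (cones X i)" using ideal_stacky_fanD(1)[OF X i] .
  then show ?thesis
    using i act lattice_preserving_isomorphism_id fan_pt_in_topspace[OF i]
    by (simp add: covers_def fan_action_def)
qed

section \<open>The induced action on the indices of cones\<close>

locale admissible_stratification =
  fixes G :: "('g, 'm) monoid_scheme"
    and X :: "('i, 'v::real_normed_vector) cone_diagram"
    and act :: "'g \<Rightarrow> ('i \<times> 'v) set \<Rightarrow> ('i \<times> 'v) set"
    and dot :: "'i \<Rightarrow> 'g \<Rightarrow> 'i"
    and L :: "'g \<Rightarrow> 'i \<Rightarrow> 'v \<Rightarrow> 'v"
    and J :: "'i set"
  assumes fan: "ideal_stacky_fan X"
    and action: "fan_action G X act"
    and choice: "covering_choice G X act dot L"
    and orbits: "orbit_representatives G X dot J"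
begin

sublocale group G
  using action by (simp add: fan_action_def)

abbreviation Q :: "('i, 'v) cone_diagram" where
  "Q \<equiv> stratified_quotient G X dot L J"

abbreviation cell :: "'i \<Rightarrow> 'v set" where
  "cell i \<equiv> pts (cones X i)"

lemma covers_L: "\<gamma> \<in> carrier G \<Longrightarrow> i \<in> idx X \<Longrightarrow> covers X act \<gamma> i (dot i \<gamma>) (L \<gamma> i)"
  using choice by (simp add: covering_choice_def)

lemma dot_in_idx: "\<gamma> \<in> carrier G \<Longrightarrow> i \<in> idx X \<Longrightarrow> dot i \<gamma> \<in> idx X"
  by (rule coversD(1)[OF covers_L])

lemma L_in_cell: "\<gamma> \<in> carrier G \<Longrightarrow> i \<in> idx X \<Longrightarrow> x \<in> cell i \<Longrightarrow> L \<gamma> i x \<in> cell (dot i \<gamma>)"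
  by (rule coversD(6)[OF covers_L])

text \<open>The chosen maps \<open>L\<close> need not respect units and products, but by
  \<open>covers_unique\<close> the target index depends only on the group element. Hence
  \<open>dot\<close> is a genuine right action.\<close>

lemma dot_one: "i \<in> idx X \<Longrightarrow> dot i \<one>\<^bsub>G\<^esub> = i"
  by (rule covers_unique[OF fan _ covers_L covers_one_id[OF fan action]]) simp_all

lemma dot_mult:
  assumes "\<gamma> \<in> carrier G" "\<delta> \<in> carrier G" "i \<in> idx X"
  shows "dot (dot i \<gamma>) \<delta> = dot i (\<gamma> \<otimes>\<^bsub>G\<^esub> \<delta>)"
  by (rule covers_unique[OF fan assms(3) covers_compose[OF action assms(1-3) covers_L covers_L] covers_L])
    (use assms dot_in_idx in auto)

lemma dot_inv: "\<gamma> \<in> carrier G \<Longrightarrow> i \<in> idx X \<Longrightarrow> dot (dot i \<gamma>) (inv\<^bsub>G\<^esub> \<gamma>) = i"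
  by (simp add: dot_mult dot_one)

lemma J_subset: "j \<in> J \<Longrightarrow> j \<in> idx X"
  using orbits by (auto simp: orbit_representatives_def)

lemma J_unique: "i \<in> J \<Longrightarrow> dot i \<gamma> \<in> J \<Longrightarrow> \<gamma> \<in> carrier G \<Longrightarrow> dot i \<gamma> = i"
  using orbits J_subset dot_one one_closed unfolding orbit_representatives_def by metis

definition rep :: "'i \<Rightarrow> 'g" where
  "rep i = (SOME \<gamma>. \<gamma> \<in> carrier G \<and> dot i \<gamma> \<in> J)"

lemma rep: "i \<in> idx X \<Longrightarrow> rep i \<in> carrier G" "i \<in> idx X \<Longrightarrow> dot i (rep i) \<in> J"
proof -
  assume "i \<in> idx X"
  then have "\<exists>\<gamma>. \<gamma> \<in> carrier G \<and> dot i \<gamma> \<in> J"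
    using orbits unfolding orbit_representatives_def by blast
  from someI_ex[OF this] show "rep i \<in> carrier G" "dot i (rep i) \<in> J" by (auto simp: rep_def)
qed

section \<open>Identifications in the stratified quotient\<close>

lemma idx_Q [simp]: "idx Q = J" and cones_Q [simp]: "cones Q = cones X"
  by (simp_all add: stratified_quotient_def)

lemma face_inclsD:
  assumes "(i, j, M) \<in> face_incls X"
  shows "i \<in> idx X" "j \<in> idx X" "lattice_preserving_inclusion (cones X i) (cones X j) M"
    "\<And>x. x \<in> cell i \<Longrightarrow> M x \<in> cell j"
    "\<And>x. x \<in> cell i \<Longrightarrow> fan_pt X j (M x) = fan_pt X i x"
  using assms lattice_preserving_inclusion_pts by (auto simp: face_incls_def)

text \<open>The face inclusion in a gluing map \<open>M \<circ> L \<gamma> i\<close> leaves the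
  point of \<open>X\<close> fixed, so on points of \<open>X\<close> the gluing map acts as
  \<open>\<gamma>\<close>.\<close>

lemma incls_Q_inclusion:
  assumes "(i, j, N) \<in> incls Q"
  shows "i \<in> J" "j \<in> J" "lattice_preserving_inclusion (cones X i) (cones X j) N"
    "\<exists>\<gamma>\<in>carrier G. \<forall>x\<in>cell i. fan_pt X j (N x) = act \<gamma> (fan_pt X i x)"
proof -
  obtain M \<gamma> where *: "i \<in> J" "j \<in> J" "N = M \<circ> L \<gamma> i" "\<gamma> \<in> carrier G" "(dot i \<gamma>, j, M) \<in> face_incls X"
    using assms unfolding stratified_quotient_def by auto
  note cov = covers_L[OF *(4) J_subset[OF *(1)]]
  show "i \<in> J" "j \<in> J" by fact+
  show "lattice_preserving_inclusion (cones X i) (cones X j) N"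
    unfolding *(3)
    by (rule lattice_preserving_inclusion_compose_isomorphism[OF coversD(2)[OF cov] face_inclsD(3)[OF *(5)]])
  have "fan_pt X j (N x) = act \<gamma> (fan_pt X i x)" if "x \<in> cell i" for x
    using face_inclsD(5)[OF *(5)] coversD(4,6)[OF cov that] by (simp add: *(3))
  then show "\<exists>\<gamma>\<in>carrier G. \<forall>x\<in>cell i. fan_pt X j (N x) = act \<gamma> (fan_pt X i x)"
    using *(4) by blast
qed

lemma glue_Q:
  assumes "i \<in> J" "j \<in> J" "\<gamma> \<in> carrier G" "(dot i \<gamma>, j, M) \<in> face_incls X" and x: "x \<in> cell i"
  shows "fan_pt Q i x = fan_pt Q j (M (L \<gamma> i x))"
proof -
  have "(i, j, M \<circ> L \<gamma> i) \<in> incls Q" using assms unfolding stratified_quotient_def by auto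
  then have "basic_glue Q (i, x) (j, (M \<circ> L \<gamma> i) x)" using x
    unfolding basic_glue_def by (intro bexI[of _ "(i, j, M \<circ> L \<gamma> i)"]) auto
  moreover have "M (L \<gamma> i x) \<in> cell j"
    using face_inclsD(4)[OF assms(4)] L_in_cell assms J_subset by blast
  ultimately show ?thesis using assms by (subst fan_pt_eq_iff) auto
qed

text \<open>
  The maps \<open>L \<one> i\<close>, and below the composites of \<open>L \<gamma> i\<close> with \<open>L (inv \<gamma>) (dot i \<gamma>)\<close>, need not be
  identities and may have infinite order. They are surjective on the cone, however, so it suffices
  to compare points in their images.
\<close>

lemma fan_pt_Q_face_incl:
  assumes ij: "i \<in> J" "j \<in> J" and N: "(i, j, N) \<in> face_incls X" and x: "x \<in> cell i"
  shows "fan_pt Q i x = fan_pt Q j (N x)"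
proof -
  have i: "i \<in> idx X" using ij J_subset by blast
  have "L \<one>\<^bsub>G\<^esub> i ` cell i = cell i"
    using coversD(5)[OF covers_L[OF one_closed i]] by (simp add: dot_one[OF i])
  then obtain y where y: "y \<in> cell i" "x = L \<one>\<^bsub>G\<^esub> i y" using x by blast
  have id: "(i, i, id) \<in> face_incls X"
    using coversD[OF covers_one_id[OF fan action i]] i by (simp add: face_incls_def)
  \<comment> \<open>Both \<open>id\<close> and \<open>N\<close>, precomposed with
    \<open>L \<one> i\<close>, are gluing maps of the quotient; applied to \<open>y\<close> they
    give \<open>x\<close> and \<open>N x\<close>.\<close>
  have "fan_pt Q i y = fan_pt Q i (id (L \<one>\<^bsub>G\<^esub> i y))"
    using glue_Q[OF ij(1) ij(1) one_closed _ y(1), of id] id by (simp only: dot_one[OF i])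
  moreover have "fan_pt Q i y = fan_pt Q j (N (L \<one>\<^bsub>G\<^esub> i y))"
    using glue_Q[OF ij one_closed _ y(1), of N] N by (simp only: dot_one[OF i])
  ultimately show ?thesis by (simp add: y(2))
qed

text \<open>Turns round trips such as a lift of \<open>\<gamma>\<close> followed by a lift of its
  inverse into face inclusions, along which the quotient is already known to glue.\<close>

lemma covers_one_face_incl:
  assumes "i \<in> idx X" "covers X act \<one>\<^bsub>G\<^esub> i j f"
  shows "(i, j, f) \<in> face_incls X"
proof -
  have "act \<one>\<^bsub>G\<^esub> (fan_pt X i x) = fan_pt X i x" if "x \<in> cell i" for x
    using action fan_pt_in_topspace[OF assms(1) that] by (simp add: fan_action_def)
  then show ?thesis using coversD[OF assms(2)] assms(1) by (simp add: face_incls_def)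
qed

text \<open>With lifts \<open>A\<close> of \<open>\<gamma>\<close> and \<open>B\<close> of its
  inverse, \<open>K \<circ> B\<close> is a face inclusion, so \<open>K \<circ> B \<circ> A\<close>
  is a gluing map. As \<open>B \<circ> A\<close> covers the identity, it glues as well, and
  comparing the two at \<open>y\<close> identifies \<open>x = B (A y)\<close> with
  \<open>K x\<close>.\<close>

lemma fan_pt_Q_translated_incl:
  assumes ij: "i \<in> J" "j \<in> J" and \<gamma>: "\<gamma> \<in> carrier G"
    and K: "lattice_preserving_inclusion (cones X i) (cones X j) K"
    and Kact: "\<And>x. x \<in> cell i \<Longrightarrow> act \<gamma> (fan_pt X i x) = fan_pt X j (K x)"
    and x: "x \<in> cell i"
  shows "fan_pt Q i x = fan_pt Q j (K x)"
proof -
  have i: "i \<in> idx X" and j: "j \<in> idx X" using ij J_subset by blast+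
  define k where "k = dot i \<gamma>"
  define A where "A = L \<gamma> i"
  define B where "B = L (inv\<^bsub>G\<^esub> \<gamma>) k"
  have k: "k \<in> idx X" using dot_in_idx[OF \<gamma> i] by (simp add: k_def)
  have A: "covers X act \<gamma> i k A" using covers_L[OF \<gamma> i] by (simp add: k_def A_def)
  have B: "covers X act (inv\<^bsub>G\<^esub> \<gamma>) k i B"
    using covers_L[OF inv_closed[OF \<gamma>] k] dot_inv[OF \<gamma> i] by (simp add: k_def B_def)
  have "covers X act (\<gamma> \<otimes>\<^bsub>G\<^esub> inv\<^bsub>G\<^esub> \<gamma>) i i (B \<circ> A)"
    by (rule covers_compose[OF action \<gamma> inv_closed[OF \<gamma>] i A B])
  then have BA: "covers X act \<one>\<^bsub>G\<^esub> i i (B \<circ> A)" using \<gamma> by simp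
  obtain y where y: "y \<in> cell i" "x = B (A y)" using coversD(5)[OF BA] x by auto
  have "(k, j, K \<circ> B) \<in> face_incls X"
    unfolding face_incls_def
  proof (intro CollectI case_prodI conjI ballI k j)
    show "lattice_preserving_inclusion (cones X k) (cones X j) (K \<circ> B)"
      by (rule lattice_preserving_inclusion_compose_isomorphism[OF coversD(2)[OF B] K])
    fix z assume z: "z \<in> cell k"
    have "act (inv\<^bsub>G\<^esub> \<gamma> \<otimes>\<^bsub>G\<^esub> \<gamma>) (fan_pt X k z) = act \<gamma> (act (inv\<^bsub>G\<^esub> \<gamma>) (fan_pt X k z))"
      using action \<gamma> fan_pt_in_topspace[OF k z] inv_closed[OF \<gamma>] unfolding fan_action_def by blast
    moreover have "act \<one>\<^bsub>G\<^esub> (fan_pt X k z) = fan_pt X k z"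
      using action fan_pt_in_topspace[OF k z] by (simp add: fan_action_def)
    ultimately show "fan_pt X j ((K \<circ> B) z) = fan_pt X k z"
      using coversD(4,6)[OF B z] Kact \<gamma> by simp
  qed
  then have "fan_pt Q i y = fan_pt Q j ((K \<circ> B) (L \<gamma> i y))"
    unfolding k_def by (rule glue_Q[OF ij \<gamma> _ y(1)])
  moreover have "fan_pt Q i y = fan_pt Q i ((B \<circ> A) y)"
    by (rule fan_pt_Q_face_incl[OF ij(1) ij(1) covers_one_face_incl[OF i BA] y(1)])
  ultimately show ?thesis by (simp add: y(2) A_def)
qed

text \<open>Well-definedness of the projection: a general \<open>M\<close> gives compatibility with
  the gluing of \<open>X\<close>, and \<open>M = id\<close> gives independence of the group element.
  Both points are compared with a point \<open>w\<close> of the representative cone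
  \<open>k\<close>.\<close>

lemma fan_pt_Q_L_cong:
  assumes M: "(i, j, M) \<in> face_incls X"
    and \<gamma>: "\<gamma> \<in> carrier G" "dot i \<gamma> \<in> J" and \<delta>: "\<delta> \<in> carrier G" "dot j \<delta> \<in> J"
    and x: "x \<in> cell i"
  shows "fan_pt Q (dot i \<gamma>) (L \<gamma> i x) = fan_pt Q (dot j \<delta>) (L \<delta> j (M x))"
proof -
  have i: "i \<in> idx X" and j: "j \<in> idx X" using face_inclsD[OF M] by blast+
  define k where "k = dot i \<gamma>"
  define A where "A = L \<gamma> i"
  define B where "B = L (inv\<^bsub>G\<^esub> \<gamma>) k"
  define D where "D = L \<delta> j"
  have k: "k \<in> idx X" "k \<in> J" using dot_in_idx[OF \<gamma>(1) i] \<gamma>(2) by (simp_all add: k_def)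
  have A: "covers X act \<gamma> i k A" using covers_L[OF \<gamma>(1) i] by (simp add: k_def A_def)
  have B: "covers X act (inv\<^bsub>G\<^esub> \<gamma>) k i B"
    using covers_L[OF inv_closed[OF \<gamma>(1)] k(1)] dot_inv[OF \<gamma>(1) i] by (simp add: k_def B_def)
  have D: "covers X act \<delta> j (dot j \<delta>) D" using covers_L[OF \<delta>(1) j] by (simp add: D_def)
  have "covers X act (inv\<^bsub>G\<^esub> \<gamma> \<otimes>\<^bsub>G\<^esub> \<gamma>) k k (A \<circ> B)"
    by (rule covers_compose[OF action inv_closed[OF \<gamma>(1)] \<gamma>(1) k(1) B A])
  then have AB: "covers X act \<one>\<^bsub>G\<^esub> k k (A \<circ> B)" using \<gamma> by simp
  obtain w where w: "w \<in> cell k" "x = B w" using coversD(5)[OF B] x by blast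
  \<comment> \<open>The composite leads from \<open>k\<close> back to \<open>i\<close>, into
    \<open>j\<close> and on to \<open>dot j \<delta>\<close>. It joins two cones of \<open>J\<close>
    and covers \<open>inv \<gamma> \<otimes> \<delta>\<close>.\<close>
  have "fan_pt Q k w = fan_pt Q (dot j \<delta>) ((D \<circ> M \<circ> B) w)"
  proof (rule fan_pt_Q_translated_incl[OF k(2) \<delta>(2)])
    show "inv\<^bsub>G\<^esub> \<gamma> \<otimes>\<^bsub>G\<^esub> \<delta> \<in> carrier G" using \<gamma> \<delta> by simp
    show "lattice_preserving_inclusion (cones X k) (cones X (dot j \<delta>)) (D \<circ> M \<circ> B)"
      by (intro lattice_preserving_inclusion_compose_isomorphism[OF coversD(2)[OF B]]
          lattice_preserving_isomorphism_compose_inclusion[OF face_inclsD(3)[OF M] coversD(2)[OF D]])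
    fix z assume z: "z \<in> cell k"
    have "act (inv\<^bsub>G\<^esub> \<gamma> \<otimes>\<^bsub>G\<^esub> \<delta>) (fan_pt X k z) = act \<delta> (act (inv\<^bsub>G\<^esub> \<gamma>) (fan_pt X k z))"
      using action \<delta>(1) fan_pt_in_topspace[OF k(1) z] inv_closed[OF \<gamma>(1)] unfolding fan_action_def by blast
    also have "\<dots> = act \<delta> (fan_pt X j (M (B z)))"
      using coversD(4,6)[OF B z] face_inclsD(5)[OF M] by simp
    also have "\<dots> = fan_pt X (dot j \<delta>) (D (M (B z)))"
      by (rule coversD(4)[OF D]) (intro face_inclsD(4)[OF M] coversD(6)[OF B z])
    finally show "act (inv\<^bsub>G\<^esub> \<gamma> \<otimes>\<^bsub>G\<^esub> \<delta>) (fan_pt X k z) = fan_pt X (dot j \<delta>) ((D \<circ> M \<circ> B) z)" by simp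
  qed (rule w(1))
  moreover have "fan_pt Q k w = fan_pt Q k ((A \<circ> B) w)"
    by (rule fan_pt_Q_face_incl[OF k(2) k(2) covers_one_face_incl[OF k(1) AB] w(1)])
  ultimately show ?thesis by (simp add: w(2) k_def A_def D_def)
qed

section \<open>The projection to the stratified quotient\<close>

text \<open>Points of the glued space are sets of pairs, so an arbitrary member \<open>q\<close>
  serves as representative; \<open>proj_fan_pt\<close> shows that the choices do not matter.\<close>

definition proj :: "('i \<times> 'v) set \<Rightarrow> ('i \<times> 'v) set" where
  "proj p = (case SOME q. q \<in> p of (i, x) \<Rightarrow> fan_pt Q (dot i (rep i)) (L (rep i) i x))"

text \<open>The map \<open>h\<close> takes equal values on basic gluings, hence on whole equivalence
  classes. Passing from \<open>rep i\<close> to another \<open>\<gamma>\<close> is the congruence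
  lemma for the identity inclusion.\<close>

lemma proj_fan_pt:
  assumes i: "i \<in> idx X" and \<gamma>: "\<gamma> \<in> carrier G" "dot i \<gamma> \<in> J" and x: "x \<in> cell i"
  shows "proj (fan_pt X i x) = fan_pt Q (dot i \<gamma>) (L \<gamma> i x)"
proof -
  define h where "h = (\<lambda>(i, x). fan_pt Q (dot i (rep i)) (L (rep i) i x))"
  have glue: "h p = h q" if "basic_glue X p q" for p q
  proof -
    obtain a b M z where M: "(a, b, M) \<in> incls X" "z \<in> cell a" "p = (a, z)" "q = (b, M z)"
      using \<open>basic_glue X p q\<close> unfolding basic_glue_def by blast
    then have M': "(a, b, M) \<in> face_incls X" using incls_subset_face_incls[OF fan] by blast
    then have "a \<in> idx X" "b \<in> idx X" by (auto dest: face_inclsD)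
    then show ?thesis
      unfolding h_def M(3,4) prod.case by (intro fan_pt_Q_L_cong[OF M'] rep M(2))
  qed
  have h: "h q = h p" if "equivclp (basic_glue X) p q" for p q
    using that by (induction rule: equivclp_induct) (auto dest: glue)
  have "equivclp (basic_glue X) (i, x) q" if "q \<in> fan_pt X i x" for q
    using that by (simp add: fan_pt_def glue_rel_def)
  then have "equivclp (basic_glue X) (i, x) (SOME q. q \<in> fan_pt X i x)"
    using fan_pt_self[OF i x] by (rule someI2[rotated])
  then have "proj (fan_pt X i x) = h (i, x)"
    unfolding proj_def using h by (simp add: h_def)
  also have "\<dots> = fan_pt Q (dot i \<gamma>) (L \<gamma> i (id x))"
    unfolding h_def prod.case
    by (intro fan_pt_Q_L_cong covers_one_face_incl covers_one_id[OF fan action] rep i \<gamma> x)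
  finally show ?thesis by simp
qed

lemma proj_is_stratified_projection: "is_stratified_projection G X dot L J proj"
  unfolding is_stratified_projection_def using proj_fan_pt by blast

text \<open>On each cone the projection is the linear map \<open>L (rep i) i\<close> followed by the
  quotient map, which gives both continuity and the local linear lifts.\<close>

lemma proj_fan_morphism: "fan_morphism X Q proj"
  unfolding fan_morphism_def
proof (intro conjI ballI)
  have pt: "proj (fan_pt X i x) = fan_pt Q (dot i (rep i)) (L (rep i) i x)"
    if "i \<in> idx X" "x \<in> cell i" for i x
    using that by (intro proj_fan_pt rep)
  have lin: "integral_linear (cones X i) (cones X (dot i (rep i))) (L (rep i) i)"
    if "i \<in> idx X" for i
    using coversD(3)[OF covers_L[OF rep(1)[OF that] that]] by (simp add: lattice_preserving_inclusion_def)
  show "continuous_map (fan_space X) (fan_space Q) proj"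
  proof (rule continuous_map_from_fan_space)
    fix i assume i: "i \<in> idx X"
    then have "ideal_cone (cones X i)" using ideal_stacky_fanD(1)[OF fan] by blast
    then have "continuous_on (cell i) (L (rep i) i)"
      using lin[OF i] by (intro continuous_on_ideal_cone) (auto simp: integral_linear_def)
    then have "continuous_map (top_of_set (cell i)) (top_of_set (cell (dot i (rep i)))) (L (rep i) i)"
      using L_in_cell[OF rep(1)[OF i] i] by auto
    moreover have "continuous_map (top_of_set (cell (dot i (rep i)))) (fan_space Q) (fan_pt Q (dot i (rep i)))"
      using continuous_map_fan_pt[of "dot i (rep i)" Q] rep(2)[OF i] by simp
    ultimately have "continuous_map (top_of_set (cell i)) (fan_space Q)
        (fan_pt Q (dot i (rep i)) \<circ> L (rep i) i)"
      by (rule continuous_map_compose)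
    then show "continuous_map (top_of_set (cell i)) (fan_space Q) (\<lambda>x. proj (fan_pt X i x))"
      by (rule continuous_map_eq) (simp add: pt[OF i])
  qed
  fix i assume i: "i \<in> idx X"
  show "\<exists>j\<in>idx Q. \<exists>f. integral_linear (cones X i) (cones Q j) f \<and> f ` cell i \<subseteq> pts (cones Q j) \<and>
      (\<forall>x\<in>cell i. proj (fan_pt X i x) = fan_pt Q j (f x))"
    using rep(2)[OF i] lin[OF i] pt[OF i] L_in_cell[OF rep(1)[OF i] i]
    by (intro bexI[of _ "dot i (rep i)"] exI[of _ "L (rep i) i"]) auto
qed

section \<open>Cells of the stratified quotient\<close>

text \<open>Induction along a chain of gluings: a forward step multiplies the group element by that
  of the gluing map, a backward step by its inverse.\<close>

lemma fan_pt_Q_eq_imp_orbit: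
  assumes i: "i \<in> J" "x \<in> cell i" and j: "j \<in> J" "y \<in> cell j" and eq: "fan_pt Q i x = fan_pt Q j y"
  shows "\<exists>\<gamma>\<in>carrier G. fan_pt X j y = act \<gamma> (fan_pt X i x)"
proof -
  let ?P = "\<lambda>(k, z). k \<in> J \<and> z \<in> cell k \<and> (\<exists>\<gamma>\<in>carrier G. fan_pt X k z = act \<gamma> (fan_pt X i x))"
  have p: "fan_pt X i x \<in> topspace (fan_space X)" using i J_subset by (intro fan_pt_in_topspace)
  have comp: "act (\<gamma> \<otimes>\<^bsub>G\<^esub> \<delta>) q = act \<delta> (act \<gamma> q)"
    if "\<gamma> \<in> carrier G" "\<delta> \<in> carrier G" "q \<in> topspace (fan_space X)" for \<gamma> \<delta> q
    using that action unfolding fan_action_def by blast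
  have one: "act \<one>\<^bsub>G\<^esub> q = q" if "q \<in> topspace (fan_space X)" for q
    using that action unfolding fan_action_def by blast
  have "equivclp (basic_glue Q) (i, x) (j, y)"
    using eq fan_pt_eq_iff[of i Q x j y] i j by simp
  then have "?P (j, y)"
  proof (induction rule: equivclp_induct)
    case base
    show ?case using i one[OF p] one_closed by auto
  next
    case (step a b)
    obtain k z where a: "a = (k, z)" by fastforce
    obtain l w where b: "b = (l, w)" by fastforce
    obtain \<gamma> where \<gamma>: "k \<in> J" "z \<in> cell k" "\<gamma> \<in> carrier G" "fan_pt X k z = act \<gamma> (fan_pt X i x)"
      using step.IH unfolding a by blast
    from step.hyps(2) show ?case
    proof
      assume "basic_glue Q a b"
      then obtain N where N: "(k, l, N) \<in> incls Q" "w = N z" unfolding basic_glue_def a b by force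
      obtain \<delta> where \<delta>: "\<delta> \<in> carrier G" "fan_pt X l w = act \<delta> (fan_pt X k z)"
        using incls_Q_inclusion(4)[OF N(1)] \<gamma>(2) N(2) by blast
      have "fan_pt X l w = act (\<gamma> \<otimes>\<^bsub>G\<^esub> \<delta>) (fan_pt X i x)" using comp[OF \<gamma>(3) \<delta>(1) p] \<delta>(2) \<gamma>(4) by simp
      then show ?case
        using \<gamma>(3) \<delta>(1) incls_Q_inclusion(2)[OF N(1)]
          lattice_preserving_inclusion_pts[OF incls_Q_inclusion(3)[OF N(1)] \<gamma>(2)] N(2)
        unfolding b by blast
    next
      assume "basic_glue Q b a"
      then obtain N where N: "(l, k, N) \<in> incls Q" "z = N w" "w \<in> cell l"
        unfolding basic_glue_def a b by force
      have l: "l \<in> J" by (rule incls_Q_inclusion(1)[OF N(1)])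
      then have q: "fan_pt X l w \<in> topspace (fan_space X)"
        using N(3) J_subset by (intro fan_pt_in_topspace)
      obtain \<delta> where \<delta>: "\<delta> \<in> carrier G" "fan_pt X k z = act \<delta> (fan_pt X l w)"
        using incls_Q_inclusion(4)[OF N(1)] N(2,3) by blast
      have "fan_pt X l w = act (\<delta> \<otimes>\<^bsub>G\<^esub> inv\<^bsub>G\<^esub> \<delta>) (fan_pt X l w)" using \<delta>(1) one[OF q] by simp
      also have "\<dots> = act (inv\<^bsub>G\<^esub> \<delta>) (act \<gamma> (fan_pt X i x))"
        unfolding \<gamma>(4)[symmetric] \<delta>(2) by (rule comp[OF \<delta>(1) inv_closed[OF \<delta>(1)] q])
      also have "\<dots> = act (\<gamma> \<otimes>\<^bsub>G\<^esub> inv\<^bsub>G\<^esub> \<delta>) (fan_pt X i x)"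
        by (rule comp[OF \<gamma>(3) inv_closed[OF \<delta>(1)] p, symmetric])
      finally show ?case using l N(3) \<gamma>(3) \<delta>(1) unfolding b by blast
    qed
  qed
  then show ?thesis by blast
qed

lemma ideal_stacky_fan_Q: "ideal_stacky_fan Q"
  unfolding ideal_stacky_fan_def
proof (intro conjI ballI)
  show "ideal_cone (cones Q i)" if "i \<in> idx Q" for i
    using that ideal_stacky_fanD(1)[OF fan J_subset] by simp
  show "case t of (i, j, N) \<Rightarrow> i \<in> idx Q \<and> j \<in> idx Q \<and>
      lattice_preserving_inclusion (cones Q i) (cones Q j) N" if "t \<in> incls Q" for t
    using that incls_Q_inclusion(1-3) by (auto split: prod.split)
  fix p assume "p \<in> topspace (fan_space Q)"
  then obtain j x where j: "j \<in> J" "x \<in> cell j" "p = fan_pt Q j x"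
    by (elim topspace_fan_space_cases) simp
  then have jX: "j \<in> idx X" using J_subset by blast
  have "fan_pt X j x \<in> topspace (fan_space X)" by (rule fan_pt_in_topspace[OF jX j(2)])
  \<comment> \<open>The cell of the quotient point is found in \<open>X\<close>: the point of
    \<open>X\<close> under \<open>x\<close> lies in the cell of some \<open>i\<close>, and the lift
    to the representative of \<open>i\<close> preserves relative interiors.\<close>
  then obtain i y where i: "i \<in> idx X" "y \<in> rel_interior (cell i)" "fan_pt X i y = fan_pt X j x"
    using ideal_stacky_fanD(2)[OF fan] by metis
  have "dot i (rep i) \<in> J" using rep i by blast
  moreover have "L (rep i) i y \<in> rel_interior (cell (dot i (rep i)))"
    using lattice_preserving_isomorphism_rel_interior[OF ideal_stacky_fanD(1)[OF fan i(1)]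
        coversD(2)[OF covers_L[OF rep(1)[OF i(1)] i(1)]] i(2)] .
  moreover have "fan_pt Q (dot i (rep i)) (L (rep i) i y) = p"
  proof -
    have y: "y \<in> cell i" using i(2) rel_interior_subset by blast
    \<comment> \<open>The same point of \<open>X\<close> is projected in two ways: from cone
      \<open>i\<close> through \<open>rep i\<close>, and from cone \<open>j\<close> in
      \<open>J\<close> through the unit.\<close>
    have "fan_pt Q (dot i (rep i)) (L (rep i) i y) = proj (fan_pt X j x)"
      using proj_fan_pt[OF i(1) rep(1)[OF i(1)] rep(2)[OF i(1)] y] i(3) by simp
    also have "\<dots> = fan_pt Q j (L \<one>\<^bsub>G\<^esub> j x)"
      using proj_fan_pt[OF jX one_closed _ j(2)] j(1) by (simp add: dot_one[OF jX])
    also have "\<dots> = fan_pt Q j x"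
      using fan_pt_Q_face_incl[OF j(1) j(1) covers_one_face_incl[OF jX] j(2)]
        covers_L[OF one_closed jX] by (simp add: dot_one[OF jX])
    finally show ?thesis using j(3) by simp
  qed
  moreover have "a = b"
    if a: "a \<in> J" "u \<in> rel_interior (cell a)" "fan_pt Q a u = p"
      and b: "b \<in> J" "v \<in> rel_interior (cell b)" "fan_pt Q b v = p" for a b u v
  proof -
    have aX: "a \<in> idx X" "u \<in> cell a" and bX: "b \<in> idx X" "v \<in> cell b"
      using a b J_subset rel_interior_subset by blast+
    obtain \<gamma> where \<gamma>: "\<gamma> \<in> carrier G" "fan_pt X b v = act \<gamma> (fan_pt X a u)"
      using fan_pt_Q_eq_imp_orbit[OF a(1) aX(2) b(1) bX(2)] a(3) b(3) by blast
    note cov = covers_L[OF \<gamma>(1) aX(1)]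
    have "L \<gamma> a u \<in> rel_interior (cell (dot a \<gamma>))"
      using lattice_preserving_isomorphism_rel_interior[OF ideal_stacky_fanD(1)[OF fan aX(1)]
          coversD(2)[OF cov] a(2)] .
    moreover have "fan_pt X b v = fan_pt X (dot a \<gamma>) (L \<gamma> a u)"
      using \<gamma>(2) coversD(4)[OF cov aX(2)] by simp
    \<comment> \<open>The translate of the cell of \<open>a\<close> meets the cell of
      \<open>b\<close> in \<open>X\<close>, so the two cells coincide; \<open>a\<close> and
      \<open>b\<close> are then representatives of one orbit.\<close>
    ultimately have "b = dot a \<gamma>"
      using cell_unique[OF fan bX(1) coversD(1)[OF cov] b(2)] by blast
    then show ?thesis using J_unique[OF a(1) _ \<gamma>(1)] b(1) by simp
  qed
  ultimately show "\<exists>!i. i \<in> idx Q \<and> (\<exists>x\<in>rel_interior (pts (cones Q i)). fan_pt Q i x = p)"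
    unfolding idx_Q cones_Q by (intro ex1I[of _ "dot i (rep i)"]) blast+
qed

end

theorem proposition2p2p6:
  fixes G :: "('g, 'm) monoid_scheme"
    and X :: "('i, 'v::real_normed_vector) cone_diagram"
    and act :: "'g \<Rightarrow> ('i \<times> 'v) set \<Rightarrow> ('i \<times> 'v) set"
    and dot :: "'i \<Rightarrow> 'g \<Rightarrow> 'i"
    and L :: "'g \<Rightarrow> 'i \<Rightarrow> 'v \<Rightarrow> 'v"
    and J :: "'i set"
  assumes "ideal_stacky_fan X"
    and "admissible_action G X act"
    and "covering_choice G X act dot L"
    and "orbit_representatives G X dot J"
  shows "ideal_stacky_fan (stratified_quotient G X dot L J) \<and>
         (\<exists>f. is_stratified_projection G X dot L J f \<and>
              fan_morphism X (stratified_quotient G X dot L J) f)"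
proof -
  interpret admissible_stratification G X act dot L J
    using assms by unfold_locales (auto simp: admissible_action_def)
  show ?thesis
    using ideal_stacky_fan_Q proj_is_stratified_projection proj_fan_morphism by blast
qed

end
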